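(* For each $k\in\mathcal K$, let $\hat{\mathbf u}_k$ be the linear minimum mean-square error (LMMSE) estimate of the downlink cascaded channel $\mathbf u_k$ from the noisy observation $\mathbf r_k$. Then $$\mathbf u_k=\hat{\mathbf u}_k+\mathbf e_k,$$ where $\hat{\mathbf u}_k$ and $\mathbf e_k$ have zero mean and covariance matrices $\mathbb E\{\hat{\mathbf u}_k^{\mathsf H}\hat{\mathbf u}_k\}=\boldsymbol\Psi_k=\mathbf R_k\mathbf Q_k\mathbf R_k$ and $\mathbb E\{\mathbf e_k^{\mathsf H}\mathbf e_k\}=\mathbf E_k=\mathbf R_k-\boldsymbol\Psi_k$, respectively, with $$\mathbf Q_k=\Big(\mathbf R_k+\frac{\sigma_{\mathrm dk}^2}{\tau_{\mathrm{dp}}p_{\mathrm{Train}}}\mathbf I_{M_{\mathrm T}}\Big)^{-1}.$$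
   Context: $(\cdot)^{\mathsf H}$ is conjugate transpose, $\mathrm{Tr}$ the trace, $\mathcal{CN}$ the circularly symmetric complex Gaussian law. $\mathcal K=\{1,\dots,K\}$ indexes users, each with a label $w_k\in\{\mathrm r,\mathrm t\}$. $\mathbf R_{\mathrm b}\in\mathbb C^{M_{\mathrm T}\times M_{\mathrm T}}$ and $\mathbf R_{\mathrm s}\in\mathbb C^{N\times N}$ are deterministic Hermitian positive semidefinite matrices, $\delta_g,\delta_{h_k}>0$, and $\boldsymbol\Theta_{\mathrm r},\boldsymbol\Theta_{\mathrm t}\in\mathbb C^{N\times N}$ are deterministic diagonal matrices. Let $\mathbf G=\sqrt{\delta_g}\,\mathbf R_{\mathrm s}^{1/2}\mathbf D\mathbf R_{\mathrm b}^{1/2}$ and $\mathbf h_k=\sqrt{\delta_{h_k}}\,\mathbf c_k\mathbf R_{\mathrm s}^{1/2}$, where $\mathbf D\in\mathbb C^{N\times M_{\mathrm T}}$ and $\mathbf c_k\in\mathbb C^{1\times N}$ are independent with i.i.d. $\mathcal{CN}(0,1)$ entries. The downlink cascaded channel is the row vector $\mathbf u_k=\mathbf h_k\boldsymbol\Theta_{w_k}\mathbf G\in\mathbb C^{1\times M_{\mathrm T}}$, with covariance $\mathbf R_k=\mathbb E\{\mathbf u_k^{\mathsf H}\mathbf u_k\}=\delta_g\delta_{h_k}\mathrm{Tr}(\mathbf R_{\mathrm s}\boldsymbol\Theta_{w_k}\mathbf R_{\mathrm s}\boldsymbol\Theta_{w_k}^{\mathsf H})\mathbf R_{\mathrm b}$.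 The noisy observation after pilot processing is $\mathbf r_k=\mathbf u_k+\mathbf n_k$, where $\mathbf n_k\in\mathbb C^{1\times M_{\mathrm T}}$ is independent of the channels and has i.i.d. $\mathcal{CN}(0,\frac{\sigma_{\mathrm dk}^2}{\tau_{\mathrm{dp}}p_{\mathrm{Train}}})$ entries; $\sigma_{\mathrm dk}^2>0$ is the noise variance at user $k$, $\tau_{\mathrm{dp}}$ the downlink pilot length and $p_{\mathrm{Train}}>0$ the pilot power. The LMMSE estimate is $\hat{\mathbf u}_k=\mathbf r_k\mathbf M$ with the matrix $\mathbf M\in\mathbb C^{M_{\mathrm T}\times M_{\mathrm T}}$ minimizing $\mathbb E\{\|\mathbf u_k-\mathbf r_k\mathbf M\|^2\}$. *)

theory Defs
  imports "HOL-Probability.Probability"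
begin

text \<open>A vector in \<open>\<complex>\<^sup>1\<^sup>\<times>\<^sup>m\<close> is a one-row matrix of type \<open>complex^'m^1\<close>; on this type the
  library's \<open>norm\<close> is the Euclidean norm.\<close>

definition ctranspose :: "complex^'m^'n \<Rightarrow> complex^'n^'m" where
  "ctranspose A = map_matrix cnj (transpose A)"

definition hermitian_psd :: "complex^'n^'n \<Rightarrow> bool" where
  "hermitian_psd A \<longleftrightarrow>
     ctranspose A = A \<and> (\<forall>x. 0 \<le> Re (\<Sum>i\<in>UNIV. cnj (x $ i) * (A *v x) $ i))"

definition psd_sqrt :: "complex^'n^'n \<Rightarrow> complex^'n^'n" where
  "psd_sqrt A = (THE B. hermitian_psd B \<and> B ** B = A)"

text \<open>The law \<open>\<C>\<N>(0, v)\<close> for \<open>v > 0\<close>. The second argument of \<open>normal_density\<close> is the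
  standard deviation, so each of the two parts has variance \<open>v / 2\<close>.\<close>

definition complex_gaussian :: "'a measure \<Rightarrow> real \<Rightarrow> ('a \<Rightarrow> complex) \<Rightarrow> bool" where
  "complex_gaussian P v Z \<longleftrightarrow>
     prob_space.indep_var P borel (\<lambda>\<omega>. Re (Z \<omega>)) borel (\<lambda>\<omega>. Im (Z \<omega>)) \<and>
     distributed P lborel (\<lambda>\<omega>. Re (Z \<omega>)) (\<lambda>x. ennreal (normal_density 0 (sqrt (v / 2)) x)) \<and>
     distributed P lborel (\<lambda>\<omega>. Im (Z \<omega>)) (\<lambda>x. ennreal (normal_density 0 (sqrt (v / 2)) x))"

definition iid_complex_gaussian ::
    "'a measure \<Rightarrow> real \<Rightarrow> ('a \<Rightarrow> complex^'m^'n) \<Rightarrow> bool" where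
  "iid_complex_gaussian P v X \<longleftrightarrow>
     prob_space.indep_vars P (\<lambda>_. borel) (\<lambda>(i, j) \<omega>. X \<omega> $ i $ j) (UNIV :: ('n \<times> 'm) set) \<and>
     (\<forall>i j. complex_gaussian P v (\<lambda>\<omega>. X \<omega> $ i $ j))"

text \<open>Independence of two random elements. The library's \<open>prob_space.indep_var\<close> forces both to have
  the same codomain type, which matrices of different dimensions do not; otherwise the two agree.\<close>

definition indep_elements ::
    "'a measure \<Rightarrow> ('a \<Rightarrow> 'b::topological_space) \<Rightarrow> ('a \<Rightarrow> 'c::topological_space) \<Rightarrow> bool" where
  "indep_elements P X Y \<longleftrightarrow>
     X \<in> borel_measurable P \<and> Y \<in> borel_measurable P \<and>
     prob_space.indep_set P
       {X -` A \<inter> space P | A. A \<in> sets borel} {Y -` B \<inter> space P | B. B \<in> sets borel}"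

text \<open>Integrability is required explicitly because the Bochner integral of a non-integrable
  function is 0.\<close>

definition zero_mean_with_cov ::
    "'a measure \<Rightarrow> ('a \<Rightarrow> complex^'m^1) \<Rightarrow> complex^'m^'m \<Rightarrow> bool" where
  "zero_mean_with_cov P X C \<longleftrightarrow>
     integrable P X \<and> (\<integral>\<omega>. X \<omega> \<partial>P) = 0 \<and>
     integrable P (\<lambda>\<omega>. ctranspose (X \<omega>) ** X \<omega>) \<and>
     (\<integral>\<omega>. ctranspose (X \<omega>) ** X \<omega> \<partial>P) = C"

definition lmmse_matrix ::
    "'a measure \<Rightarrow> ('a \<Rightarrow> complex^'m^1) \<Rightarrow> ('a \<Rightarrow> complex^'l^1) \<Rightarrow> complex^'m^'l" where
  "lmmse_matrix P u r = (ARG_MIN (\<lambda>W. \<integral>\<omega>. (norm (u \<omega> - r \<omega> ** W))\<^sup>2 \<partial>P) W. True)"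

definition lmmse_estimate ::
    "'a measure \<Rightarrow> ('a \<Rightarrow> complex^'m^1) \<Rightarrow> ('a \<Rightarrow> complex^'l^1) \<Rightarrow> 'a \<Rightarrow> complex^'m^1" where
  "lmmse_estimate P u r \<omega> = r \<omega> ** lmmse_matrix P u r"

datatype user_side = Reflection | Transmission

end

theory Submission
  imports Defs
begin

text \<open>
  Write \<open>u\<^sub>k = (Y D) A\<close> with the row \<open>Y = c\<^sub>k T\<close>, \<open>T = R\<^sub>s\<^sup>1\<^sup>/\<^sup>2 \<Theta> R\<^sub>s\<^sup>1\<^sup>/\<^sup>2\<close>, and
  \<open>A\<close> a multiple of \<open>R\<^sub>b\<^sup>1\<^sup>/\<^sup>2\<close>. As \<open>D\<close> is white and independent of \<open>Y\<close>, the second moment of \<open>Y D\<close>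
  is \<open>Tr (E (Y\<^sup>H Y)) I = Tr (T\<^sup>H T) I\<close>, which gives \<open>R\<^sub>k\<close>. With \<open>S = R\<^sub>k + v I\<close>,
  \<open>W\<^sub>0 = S\<^sup>-\<^sup>1 R\<^sub>k\<close> and \<open>e = u - r W\<^sub>0\<close>, the error \<open>e\<close> is uncorrelated with \<open>r\<close>, so the mean-square
  error of \<open>W\<close> exceeds that of \<open>W\<^sub>0\<close> by \<open>Tr ((W - W\<^sub>0)\<^sup>H S (W - W\<^sub>0)) \<ge> v \<parallel>W - W\<^sub>0\<parallel>\<^sup>2\<close>; hence
  \<open>W\<^sub>0\<close> is the only minimizer.

  Matrix square roots come from the real spectral theorem: \<open>\<complex>\<^sup>n\<close> is a real inner product space, and a
  positive root over the reals is complex linear because, roots being unique, it is fixed under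
  conjugation by multiplication with \<open>\<i>\<close>.
\<close>

subsection \<open>Square roots of positive operators\<close>

text \<open>The form is tested at \<open>v - t *\<^sub>R w\<close> with \<open>w = T v\<close>.
  There it equals \<open>- 2 * t * a + t * t * b\<close>, which is negative for small positive
  \<open>t\<close> unless \<open>w = 0\<close>. Positivity is asked on \<open>V\<close> only,
  because the eigenvector argument below has it only there.\<close>

lemma positive_form_kernel:
  fixes T :: "'a::real_inner \<Rightarrow> 'a"
  assumes lin: "linear T" and sa: "\<And>x y. T x \<bullet> y = x \<bullet> T y"
    and V: "subspace V" "T ` V \<subseteq> V" and pos: "\<And>x. x \<in> V \<Longrightarrow> 0 \<le> x \<bullet> T x"
    and v: "v \<in> V" "v \<bullet> T v = 0"
  shows "T v = 0"
proof (rule ccontr)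
  assume nz: "T v \<noteq> 0"
  define w where "w = T v"
  define a where "a = w \<bullet> w"
  define b where "b = w \<bullet> T w"
  \<comment> \<open>Chosen to give \<open>t * b \<le> a\<close>; the \<open>+ 1\<close> covers the
    case \<open>b = 0\<close>.\<close>
  define t where "t = a / (b + 1)"
  have wV: "w \<in> V" using V v by (auto simp: w_def)
  have a: "a > 0" using nz by (simp add: a_def w_def)
  have b: "b \<ge> 0" using pos wV by (simp add: b_def)
  have t: "t > 0" using a b by (simp add: t_def)
  have "v - t *\<^sub>R w \<in> V" using V v wV by (simp add: subspace_diff subspace_scale)
  from pos[OF this] have "0 \<le> - 2 * t * a + t * t * b"
    using v sa[of w v]
    by (simp add: linear_diff[OF lin] linear_scale[OF lin] inner_diff_left inner_diff_right
        a_def b_def w_def[symmetric] inner_commute algebra_simps)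
  then have "0 \<le> t * (t * b - 2 * a)" by (simp add: algebra_simps)
  then have "2 * a \<le> t * b" using t by (simp add: zero_le_mult_iff)
  moreover have "t * b \<le> a" using a b by (simp add: t_def field_simps)
  ultimately show False using a by simp
qed

text \<open>A maximizer \<open>v\<close> of \<open>x \<bullet> T x\<close> on the unit sphere of
  \<open>V\<close> is an eigenvector. With \<open>l\<close> the maximum, the form of
  \<open>l I - T\<close> is nonnegative on \<open>V\<close> and vanishes at \<open>v\<close>, so
  \<open>positive_form_kernel\<close> puts \<open>v\<close> in its kernel.\<close>

lemma selfadjoint_eigenvector:
  fixes T :: "'a::euclidean_space \<Rightarrow> 'a"
  assumes lin: "linear T" and sa: "\<And>x y. T x \<bullet> y = x \<bullet> T y"
    and V: "subspace V" "T ` V \<subseteq> V" and nz: "a \<in> V" "a \<noteq> 0"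
  obtains v l where "v \<in> V" "norm v = 1" "T v = l *\<^sub>R v"
proof -
  have cT: "continuous_on A T" for A
    using lin by (simp add: linear_continuous_on linear_conv_bounded_linear)
  have "compact (sphere 0 1 \<inter> V)"
    by (intro compact_Int_closed compact_sphere closed_subspace V)
  moreover have "a /\<^sub>R norm a \<in> sphere 0 1 \<inter> V"
    using V nz by (auto simp: subspace_scale)
  moreover have "continuous_on (sphere 0 1 \<inter> V) (\<lambda>x. x \<bullet> T x)"
    by (intro continuous_intros cT)
  ultimately obtain v where v: "v \<in> sphere 0 1 \<inter> V"
    and max: "\<And>y. y \<in> sphere 0 1 \<inter> V \<Longrightarrow> y \<bullet> T y \<le> v \<bullet> T v"
    using continuous_attains_sup[of "sphere 0 1 \<inter> V" "\<lambda>x. x \<bullet> T x"] by blast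
  define l where "l = v \<bullet> T v"
  have vv: "v \<bullet> v = 1" using v by (simp add: norm_eq_1)
  define S where "S x = l *\<^sub>R x - T x" for x
  have "S v = 0"
  proof (rule positive_form_kernel[of S V v])
    show "linear S" unfolding S_def
      by (intro linear_compose_sub linear_scale_self lin)
    show "S x \<bullet> y = x \<bullet> S y" for x y
      by (simp add: S_def inner_diff_left inner_diff_right sa)
    show "S ` V \<subseteq> V" using V by (auto simp: S_def subspace_diff subspace_scale)
    show "v \<bullet> S v = 0" by (simp add: S_def inner_diff_right vv l_def)
    \<comment> \<open>Maximality on the sphere extends to all of \<open>V\<close> by
      scaling.\<close>
    show "0 \<le> x \<bullet> S x" if "x \<in> V" for x
    proof (cases "x = 0")
      case False
      have "x /\<^sub>R norm x \<in> sphere 0 1 \<inter> V" using V that False by (auto simp: subspace_scale)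
      from max[OF this] have "(x \<bullet> T x) / (norm x)\<^sup>2 \<le> l"
        by (simp add: linear_scale[OF lin] l_def power2_eq_square field_simps)
      then show ?thesis using False
        by (simp add: S_def inner_diff_right power2_norm_eq_inner field_simps)
    qed simp
  qed (use V v in auto)
  then show thesis using that[of v l] v by (simp add: S_def)
qed

text \<open>An orthonormal set of eigenvectors of largest cardinality must span: the vectors
  orthogonal to it form a \<open>T\<close>-invariant subspace, and a unit eigenvector found there
  would enlarge the set. Such a largest set exists because orthonormal sets are independent, hence
  bounded in size by the dimension.\<close>

lemma selfadjoint_eigenbasis:
  fixes T :: "'a::euclidean_space \<Rightarrow> 'a"
  assumes lin: "linear T" and sa: "\<And>x y. T x \<bullet> y = x \<bullet> T y"
  obtains B l where "finite B" "pairwise orthogonal B" "span B = UNIV"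
    "\<And>b. b \<in> B \<Longrightarrow> norm b = 1" "\<And>b. b \<in> B \<Longrightarrow> T b = l b *\<^sub>R b"
proof -
  define ok where "ok B \<longleftrightarrow> pairwise orthogonal B \<and> (\<forall>b\<in>B. norm b = 1 \<and> (\<exists>l. T b = l *\<^sub>R b))"
    for B
  have bound: "finite B \<and> card B \<le> DIM('a)" if "ok B" for B
  proof -
    have "independent B"
      using that by (intro pairwise_orthogonal_independent) (auto simp: ok_def)
    then show ?thesis by (simp add: independent_bound)
  qed
  have "ok {}" by (simp add: ok_def)
  then obtain B where B: "ok B" and max: "\<And>C. ok C \<Longrightarrow> card C \<le> card B"
    using ex_has_greatest_nat[of ok "{}" card "Suc DIM('a)"] bound
    by (metis less_Suc_eq_le)
  have "span B = UNIV"
  proof (rule ccontr)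
    assume "span B \<noteq> UNIV"
    then obtain a where a: "a \<noteq> 0" "\<And>x. x \<in> span B \<Longrightarrow> a \<bullet> x = 0"
      using span_not_UNIV_orthogonal by blast
    define V where "V = {x. \<forall>b\<in>B. x \<bullet> b = 0}"
    have V: "subspace V" by (auto simp: V_def subspace_def inner_add_left)
    have inv: "T ` V \<subseteq> V"
    proof (rule image_subsetI)
      fix x assume x: "x \<in> V"
      have "T x \<bullet> b = 0" if b: "b \<in> B" for b
      proof -
        obtain l where "T b = l *\<^sub>R b" using B b unfolding ok_def by blast
        then show ?thesis using x b by (simp add: sa V_def)
      qed
      then show "T x \<in> V" by (simp add: V_def)
    qed
    have "a \<in> V" using a by (auto simp: V_def span_base)
    then obtain v l where v: "v \<in> V" "norm v = 1" "T v = l *\<^sub>R v"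
      using selfadjoint_eigenvector[OF lin sa V inv] a by blast
    have "v \<notin> B" using v by (auto simp: V_def)
    moreover have "ok (insert v B)"
      using B v by (auto simp: ok_def pairwise_insert V_def orthogonal_def inner_commute)
    ultimately show False using max[of "insert v B"] bound[OF B] by simp
  qed
  moreover obtain l where "\<And>b. b \<in> B \<Longrightarrow> T b = l b *\<^sub>R b"
    using B unfolding ok_def by metis
  ultimately show thesis using that[of B l] B bound by (auto simp: ok_def)
qed

text \<open>Everything is over the reals, so on a complex space complex linearity is not built in;
  for roots of a complex matrix it is recovered in
  \<open>positive_operator_complex_linear\<close>.\<close>

definition positive_operator :: "('a::real_inner \<Rightarrow> 'a) \<Rightarrow> bool" where
  "positive_operator T \<longleftrightarrow>
     linear T \<and> (\<forall>x y. T x \<bullet> y = x \<bullet> T y) \<and> (\<forall>x. 0 \<le> x \<bullet> T x)"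

lemma positive_operator_kernel:
  assumes "positive_operator T" "v \<bullet> T v = 0"
  shows "T v = 0"
  using assms by (intro positive_form_kernel[of T UNIV]) (auto simp: positive_operator_def)

text \<open>In an orthonormal eigenbasis each eigenvalue is replaced by its square root; positivity
  of \<open>T\<close> makes the eigenvalues nonnegative.\<close>

lemma positive_operator_sqrt_exists:
  fixes T :: "'a::euclidean_space \<Rightarrow> 'a"
  assumes T: "positive_operator T"
  obtains S where "positive_operator S" "\<And>x. S (S x) = T x"
proof -
  obtain B l where fin: "finite B" and orth: "pairwise orthogonal B" and span: "span B = UNIV"
    and unit: "\<And>b. b \<in> B \<Longrightarrow> norm b = 1" and eig: "\<And>b. b \<in> B \<Longrightarrow> T b = l b *\<^sub>R b"
    using selfadjoint_eigenbasis[of T] T unfolding positive_operator_def by metis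
  have l: "0 \<le> l b" if "b \<in> B" for b
  proof -
    have "0 \<le> b \<bullet> T b" using T by (simp add: positive_operator_def)
    then show ?thesis using that unit[of b] by (simp add: eig norm_eq_1)
  qed
  define S where "S x = (\<Sum>b\<in>B. (sqrt (l b) * (b \<bullet> x)) *\<^sub>R b)" for x
  have lin: "linear S"
    by (rule linearI)
      (simp_all add: S_def inner_add_right algebra_simps sum.distrib scaleR_sum_right)
  have inner: "S x \<bullet> y = (\<Sum>b\<in>B. sqrt (l b) * (b \<bullet> x) * (b \<bullet> y))" for x y
    by (simp add: S_def inner_sum_left)
  have "positive_operator S"
    unfolding positive_operator_def
  proof (intro conjI allI lin)
    show "S x \<bullet> y = x \<bullet> S y" for x y
      by (subst (2) inner_commute) (simp add: inner mult_ac)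
    show "0 \<le> x \<bullet> S x" for x
      by (subst inner_commute) (simp add: inner mult.assoc l sum_nonneg)
  qed
  moreover have Sb: "S b = sqrt (l b) *\<^sub>R b" if "b \<in> B" for b
  proof -
    have "S b = (\<Sum>b'\<in>B. if b' = b then sqrt (l b) *\<^sub>R b else 0)"
      unfolding S_def using that orth unit[OF that]
      by (intro sum.cong) (auto simp: pairwise_def orthogonal_def norm_eq_1)
    then show ?thesis using that fin by simp
  qed
  moreover have "S (S x) = T x" for x
  proof -
    have "(S \<circ> S) x = T x"
    proof (rule linear_eq_on_span[of "S \<circ> S" T B])
      show "linear (S \<circ> S)" by (rule linear_compose[OF lin lin])
      show "linear T" using T by (simp add: positive_operator_def)
      show "(S \<circ> S) b = T b" if "b \<in> B" for b
        using that l[OF that] by (simp add: Sb linear_scale[OF lin] eig)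
    qed (simp add: span)
    then show ?thesis by simp
  qed
  ultimately show thesis using that by blast
qed

text \<open>The difference \<open>X = S - T\<close> is self-adjoint, so it suffices to show that it
  kills an eigenbasis. Equality of the squares gives \<open>S X + X T = 0\<close>, with no
  commutation assumed. Pairing this with an eigenvector \<open>b\<close> yields
  \<open>l b * (b \<bullet> S b + b \<bullet> T b) = 0\<close>. If \<open>l b\<close> is nonzero,
  both nonnegative forms vanish at \<open>b\<close>, whence \<open>S b = T b = 0\<close> and
  \<open>X b = 0\<close>, a contradiction.\<close>

lemma positive_operator_sqrt_unique:
  fixes S T :: "'a::euclidean_space \<Rightarrow> 'a"
  assumes S: "positive_operator S" and T: "positive_operator T"
    and sq: "\<And>x. S (S x) = T (T x)"
  shows "S = T"
proof -
  define X where "X x = S x - T x" for x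
  have linS: "linear S" and saS: "\<And>x y. S x \<bullet> y = x \<bullet> S y" and posS: "\<And>x. 0 \<le> x \<bullet> S x"
    and linT: "linear T" and saT: "\<And>x y. T x \<bullet> y = x \<bullet> T y" and posT: "\<And>x. 0 \<le> x \<bullet> T x"
    using S T by (auto simp: positive_operator_def)
  have linX: "linear X" unfolding X_def by (intro linear_compose_sub linS linT)
  have saX: "X x \<bullet> y = x \<bullet> X y" for x y
    by (simp add: X_def inner_diff_left inner_diff_right saS saT)
  obtain B l where span: "span B = UNIV"
    and unit: "\<And>b. b \<in> B \<Longrightarrow> norm b = 1" and eig: "\<And>b. b \<in> B \<Longrightarrow> X b = l b *\<^sub>R b"
    using selfadjoint_eigenbasis[OF linX saX] by metis
  have zero: "X b = 0" if b: "b \<in> B" for b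
  proof (rule ccontr)
    assume nz: "X b \<noteq> 0"
    have "0 = b \<bullet> S (X b) + b \<bullet> X (T b)"
      by (simp add: X_def linear_diff[OF linS] inner_diff_right sq)
    also have "\<dots> = l b * (b \<bullet> S b + b \<bullet> T b)"
      using saX[of b "T b"] by (simp add: eig b linear_scale[OF linS] algebra_simps)
    finally have "b \<bullet> S b + b \<bullet> T b = 0" using nz eig[OF b] by auto
    then have "b \<bullet> S b = 0" "b \<bullet> T b = 0" using posS[of b] posT[of b] by auto
    then have "S b = 0" "T b = 0"
      using positive_operator_kernel S T by blast+
    then have "X b = 0" by (simp add: X_def)
    with nz show False ..
  qed
  have "X x = 0" for x
    using linear_eq_on_span[OF linX linear_zero, of B x] zero span by auto
  then show ?thesis by (auto simp: X_def)
qed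

section \<open>Complex matrices as operators on a real inner product space\<close>

lemma inner_complex_vec: "x \<bullet> y = Re (\<Sum>i\<in>UNIV. cnj (x $ i) * y $ i)"
  for x y :: "complex^'n"
  by (simp add: inner_vec_def inner_complex_def)

lemma ctranspose_component [simp]: "ctranspose A $ i $ j = cnj (A $ j $ i)"
  by (simp add: ctranspose_def map_matrix_def transpose_def)

lemma ctranspose_ctranspose [simp]: "ctranspose (ctranspose A) = A"
  by (simp add: vec_eq_iff)

lemma ctranspose_add: "ctranspose (A + B) = ctranspose A + ctranspose B"
  by (simp add: vec_eq_iff)

lemma ctranspose_diff: "ctranspose (A - B) = ctranspose A - ctranspose B"
  by (simp add: vec_eq_iff)

lemma ctranspose_mult: "ctranspose (A ** B) = ctranspose B ** ctranspose A"
  by (simp add: vec_eq_iff matrix_matrix_mult_def mult.commute)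

lemma inner_matrix_vector: "(A *v x) \<bullet> y = x \<bullet> (ctranspose A *v y)"
  for A :: "complex^'n^'m"
proof -
  have "(\<Sum>i\<in>UNIV. cnj ((A *v x) $ i) * y $ i) =
      (\<Sum>i\<in>UNIV. \<Sum>j\<in>UNIV. cnj (x $ j) * (cnj (A $ i $ j) * y $ i))"
    by (simp add: matrix_vector_mult_def sum_distrib_left sum_distrib_right mult_ac)
  also have "\<dots> = (\<Sum>j\<in>UNIV. \<Sum>i\<in>UNIV. cnj (x $ j) * (cnj (A $ i $ j) * y $ i))"
    by (rule sum.swap)
  also have "\<dots> = (\<Sum>j\<in>UNIV. cnj (x $ j) * (ctranspose A *v y) $ j)"
    by (simp add: matrix_vector_mult_def sum_distrib_left)
  finally show ?thesis by (simp only: inner_complex_vec)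
qed

lemma linear_matrix_vector: "linear ((*v) A)" for A :: "complex^'n^'m"
proof (rule linearI)
  show "A *v (x + y) = A *v x + A *v y" for x y by (rule matrix_vector_right_distrib)
  show "A *v (a *\<^sub>R x) = a *\<^sub>R (A *v x)" for a x
    by (simp add: vec_eq_iff matrix_vector_mult_def scaleR_sum_right)
qed

text \<open>The real inner product is the real part of the Hermitian one, and by
  \<open>inner_matrix_vector\<close> the real adjoint of \<open>A\<close> is
  \<open>ctranspose A\<close>. Real self-adjointness therefore already forces
  \<open>ctranspose A = A\<close>.\<close>

lemma hermitian_psd_iff: "hermitian_psd A \<longleftrightarrow> positive_operator ((*v) A)"
proof
  assume "hermitian_psd A"
  then show "positive_operator ((*v) A)"
    using inner_matrix_vector[of A]
    by (auto simp: hermitian_psd_def positive_operator_def linear_matrix_vector inner_complex_vec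
        simp del: Re_sum)
next
  assume A: "positive_operator ((*v) A)"
  then have sa: "x \<bullet> (ctranspose A *v y) = x \<bullet> (A *v y)" for x y
    by (metis inner_matrix_vector positive_operator_def)
  have "ctranspose A *v y = A *v y" for y
    using sa[of _ y] vector_eq_ldot by blast
  then have "ctranspose A = A" by (simp add: matrix_eq)
  then show "hermitian_psd A"
    using A by (simp add: hermitian_psd_def positive_operator_def inner_complex_vec del: Re_sum)
qed

text \<open>Multiplication by \<i>, called \<open>J\<close>, is skew, squares to \<open>- 1\<close>
  and commutes with \<open>A\<close>, so \<open>- J S J\<close> is again a positive root of
  \<open>A\<close>. Uniqueness of roots gives \<open>S = - J S J\<close>, that is, \<open>S\<close>
  commutes with \<open>J\<close>; together with real linearity this is complex linearity.\<close>

lemma positive_operator_complex_linear: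
  fixes S :: "complex^'n \<Rightarrow> complex^'n"
  assumes S: "positive_operator S" and sq: "\<And>x. S (S x) = A *v x"
  shows "S (z *s x) = z *s S x"
proof -
  define J :: "complex^'n \<Rightarrow> complex^'n" where "J x = \<i> *s x" for x
  have linS: "linear S" and saS: "\<And>x y. S x \<bullet> y = x \<bullet> S y" and posS: "\<And>x. 0 \<le> x \<bullet> S x"
    using S by (auto simp: positive_operator_def)
  have linJ: "linear J"
    by (rule linearI) (simp_all add: J_def vec_eq_iff algebra_simps)
  have JJ: "J (J x) = - x" for x by (simp add: J_def vec_eq_iff mult.assoc[symmetric])
  have skew: "J x \<bullet> y = - (x \<bullet> J y)" for x y
    by (simp add: inner_complex_vec J_def sum_negf[symmetric])
  have JA: "J (A *v x) = A *v (J x)" for x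
    by (simp add: J_def vec_eq_iff matrix_vector_mult_def sum_distrib_left mult_ac)
  define S' where "S' x = - J (S (J x))" for x
  have "S' = S"
  proof (rule positive_operator_sqrt_unique[OF _ S])
    have "linear (\<lambda>x. (J \<circ> (S \<circ> J)) x)"
      using linear_compose[OF linear_compose[OF linJ linS] linJ] by (simp add: o_def)
    then have "linear S'" unfolding S'_def using linear_compose_neg by fastforce
    moreover have "S' x \<bullet> y = x \<bullet> S' y" for x y
      by (simp add: S'_def skew saS)
    moreover have "0 \<le> x \<bullet> S' x" for x
      using posS[of "J x"] by (simp add: S'_def skew)
    ultimately show "positive_operator S'" by (simp add: positive_operator_def)
    show "S' (S' x) = S (S x)" for x
      by (simp add: S'_def linear_neg[OF linJ] linear_neg[OF linS] JJ sq JA[symmetric])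
  qed
  then have "S x = - J (S (J x))" for x by (metis S'_def)
  then have SJ: "S (J x) = J (S x)" for x
    by (metis JJ add.inverse_inverse linear_neg[OF linJ])
  have z: "z *s x = Re z *\<^sub>R x + Im z *\<^sub>R J x" for x
    by (simp add: vec_eq_iff J_def complex_eq_iff)
  show ?thesis
    by (simp add: z linear_add[OF linS] linear_scale[OF linS] SJ)
qed

text \<open>A definite description is usable only after existence and uniqueness. Complex linearity
  of the real root makes it the action of a matrix, and uniqueness is inherited from
  operators.\<close>

lemma psd_sqrt:
  fixes A :: "complex^'n^'n"
  assumes "hermitian_psd A"
  shows "hermitian_psd (psd_sqrt A)"
    and "psd_sqrt A ** psd_sqrt A = A"
proof -
  obtain S where S: "positive_operator S" and sq: "\<And>x. S (S x) = A *v x"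
    using positive_operator_sqrt_exists[of "(*v) A"] assms by (auto simp: hermitian_psd_iff)
  have "Vector_Spaces.linear (*s) (*s) S"
    using S positive_operator_complex_linear[OF S sq]
    by (simp add: linear_iff Vector_Spaces.linear_iff vec.vector_space_axioms positive_operator_def)
  then have B: "matrix S *v x = S x" for x by (rule matrix_works)
  then have B': "(*v) (matrix S) = S" by auto
  have "\<exists>!B. hermitian_psd B \<and> B ** B = A"
  proof (rule ex1I[of _ "matrix S"], intro conjI)
    show "hermitian_psd (matrix S)" by (simp add: hermitian_psd_iff B' S)
    show "matrix S ** matrix S = A"
      by (simp add: matrix_eq matrix_vector_mul_assoc[symmetric] B sq)
    fix C assume C: "hermitian_psd C \<and> C ** C = A"
    then have "(*v) C = S"
      by (intro positive_operator_sqrt_unique S)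
        (auto simp: hermitian_psd_iff sq matrix_vector_mul_assoc)
    then show "C = matrix S" by (simp add: matrix_eq B)
  qed
  from theI'[OF this]
  show "hermitian_psd (psd_sqrt A)" "psd_sqrt A ** psd_sqrt A = A"
    by (simp_all add: psd_sqrt_def)
qed

subsection \<open>Square-integrable random matrices\<close>

lemma bounded_linear_matrix_sandwich: "bounded_linear (\<lambda>Z. A ** Z ** B)"
  for A :: "complex^'n^'m" and B :: "complex^'l^'k"
proof -
  have "linear (\<lambda>Z. A ** Z ** B)"
    by (rule linearI)
      (simp_all add: vec_eq_iff matrix_matrix_mult_def algebra_simps sum.distrib
        scaleR_sum_right sum_distrib_left)
  then show ?thesis by (simp add: linear_conv_bounded_linear)
qed

lemma borel_measurable_matrix_nth:
  "(\<lambda>X::complex^'m^'n. X $ i $ j) \<in> borel_measurable borel"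
  by (intro borel_measurable_continuous_onI continuous_intros)

text \<open>Stated for the pair because the noise is independent of the two channel matrices
  jointly.\<close>

lemma borel_measurable_matrix_mult:
  "(\<lambda>(X, Y). X ** A ** Y) \<in> borel_measurable borel"
  for A :: "complex^'n^'k"
  unfolding matrix_matrix_mult_def case_prod_beta
  by (intro borel_measurable_continuous_onI continuous_intros)

text \<open>A matrix is the finite sum of its entries put back in place by the bounded linear maps
  \<open>S i j\<close>, so integration can be done entrywise.\<close>

lemma has_bochner_integral_matrix:
  fixes X :: "'a \<Rightarrow> complex^'m^'n"
  assumes "\<And>i j. has_bochner_integral M (\<lambda>\<omega>. X \<omega> $ i $ j) (C $ i $ j)"
  shows "has_bochner_integral M X C"
proof -
  define S :: "'n \<Rightarrow> 'm \<Rightarrow> complex \<Rightarrow> complex^'m^'n" where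
    "S i j z = (\<chi> a b. if a = i \<and> b = j then z else 0)" for i j z
  have "linear (S i j)" for i j
    by (rule linearI) (simp_all add: S_def vec_eq_iff)
  then have "bounded_linear (S i j)" for i j
    by (simp add: linear_conv_bounded_linear)
  then have "has_bochner_integral M (\<lambda>\<omega>. \<Sum>i\<in>UNIV. \<Sum>j\<in>UNIV. S i j (X \<omega> $ i $ j))
      (\<Sum>i\<in>UNIV. \<Sum>j\<in>UNIV. S i j (C $ i $ j))"
    by (intro has_bochner_integral_sum has_bochner_integral_bounded_linear[OF _ assms])
  moreover have "(\<Sum>i\<in>UNIV. \<Sum>j\<in>UNIV. S i j (Z $ i $ j)) = Z" for Z
  proof -
    have "(\<Sum>i\<in>UNIV. \<Sum>j\<in>UNIV. S i j (Z $ i $ j)) $ a $ b = Z $ a $ b" for a b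
    proof -
      have "(\<Sum>i\<in>UNIV. \<Sum>j\<in>UNIV. S i j (Z $ i $ j)) $ a $ b =
          (\<Sum>i\<in>UNIV. \<Sum>j\<in>UNIV. if i = a then if j = b then Z $ i $ j else 0 else 0)"
        unfolding S_def sum_component by (intro sum.cong refl) simp
      also have "\<dots> = (\<Sum>i\<in>UNIV. if i = a then Z $ i $ b else 0)"
        by (intro sum.cong refl) simp
      also have "\<dots> = Z $ a $ b" by simp
      finally show ?thesis .
    qed
    then show ?thesis by (simp add: vec_eq_iff)
  qed
  ultimately show ?thesis by simp
qed

lemma integrable_matrix:
  fixes X :: "'a \<Rightarrow> complex^'m^'n"
  assumes "\<And>i j. integrable M (\<lambda>\<omega>. X \<omega> $ i $ j)"
  shows "integrable M X" "(\<integral>\<omega>. X \<omega> \<partial>M) $ i $ j = (\<integral>\<omega>. X \<omega> $ i $ j \<partial>M)"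
proof -
  have "has_bochner_integral M X (\<chi> i j. \<integral>\<omega>. X \<omega> $ i $ j \<partial>M)"
    using assms by (intro has_bochner_integral_matrix) (simp add: has_bochner_integral_integrable)
  then show "integrable M X" "(\<integral>\<omega>. X \<omega> \<partial>M) $ i $ j = (\<integral>\<omega>. X \<omega> $ i $ j \<partial>M)"
    by (auto simp: has_bochner_integral_iff)
qed

text \<open>Here \<open>norm\<close> is the Frobenius norm; in this form mean-square errors can be
  read off second-moment matrices.\<close>

lemma norm_matrix_square: "(norm X)\<^sup>2 = Re (trace (ctranspose X ** X))"
  for X :: "complex^'m^'n"
proof -
  have "(norm X)\<^sup>2 = (\<Sum>k\<in>UNIV. \<Sum>i\<in>UNIV. Re (cnj (X $ k $ i) * X $ k $ i))"
    by (simp only: power2_norm_eq_inner inner_vec_def) (simp add: inner_complex_def)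
  also have "\<dots> = (\<Sum>i\<in>UNIV. \<Sum>k\<in>UNIV. Re (cnj (X $ k $ i) * X $ k $ i))"
    by (rule sum.swap)
  also have "\<dots> = Re (trace (ctranspose X ** X))"
    by (simp add: trace_def matrix_matrix_mult_def)
  finally show ?thesis .
qed

section \<open>Square-integrable complex functions\<close>

definition square_integrable :: "'a measure \<Rightarrow> ('a \<Rightarrow> complex) \<Rightarrow> bool" where
  "square_integrable M f \<longleftrightarrow>
     f \<in> borel_measurable M \<and> integrable M (\<lambda>\<omega>. (cmod (f \<omega>))\<^sup>2)"

lemma square_integrable_cnj_mult:
  assumes "square_integrable M f" "square_integrable M g"
  shows "integrable M (\<lambda>\<omega>. cnj (f \<omega>) * g \<omega>)"
proof (rule Bochner_Integration.integrable_bound)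
  show "integrable M (\<lambda>\<omega>. (cmod (f \<omega>))\<^sup>2 + (cmod (g \<omega>))\<^sup>2)"
    using assms by (simp add: square_integrable_def)
  have "(\<lambda>\<omega>. cnj (f \<omega>)) \<in> borel_measurable M"
    using assms by (intro borel_measurable_continuous_on[where f = cnj] continuous_intros)
      (auto simp: square_integrable_def)
  then show "(\<lambda>\<omega>. cnj (f \<omega>) * g \<omega>) \<in> borel_measurable M"
    using assms by (intro borel_measurable_times) (simp_all add: square_integrable_def)
  show "AE \<omega> in M. norm (cnj (f \<omega>) * g \<omega>) \<le> norm ((cmod (f \<omega>))\<^sup>2 + (cmod (g \<omega>))\<^sup>2)"
  proof (intro AE_I2)
    fix \<omega>
    have "2 * cmod (f \<omega>) * cmod (g \<omega>) \<le> (cmod (f \<omega>))\<^sup>2 + (cmod (g \<omega>))\<^sup>2"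
      by (rule sum_squares_bound)
    moreover have "0 \<le> cmod (f \<omega>) * cmod (g \<omega>)" by simp
    ultimately have "cmod (f \<omega>) * cmod (g \<omega>) \<le> (cmod (f \<omega>))\<^sup>2 + (cmod (g \<omega>))\<^sup>2"
      by linarith
    then show "norm (cnj (f \<omega>) * g \<omega>) \<le> norm ((cmod (f \<omega>))\<^sup>2 + (cmod (g \<omega>))\<^sup>2)"
      by (simp add: norm_mult)
  qed
qed

lemma square_integrable_zero: "square_integrable M (\<lambda>_. 0)"
  by (simp add: square_integrable_def)

lemma square_integrable_cmult:
  "square_integrable M f \<Longrightarrow> square_integrable M (\<lambda>\<omega>. z * f \<omega>)"
  by (auto simp: square_integrable_def norm_mult power_mult_distrib
      intro: borel_measurable_times borel_measurable_const)

lemma square_integrable_add: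
  assumes "square_integrable M f" "square_integrable M g"
  shows "square_integrable M (\<lambda>\<omega>. f \<omega> + g \<omega>)"
  unfolding square_integrable_def
proof
  show meas: "(\<lambda>\<omega>. f \<omega> + g \<omega>) \<in> borel_measurable M"
    using assms by (intro borel_measurable_add) (simp_all add: square_integrable_def)
  show "integrable M (\<lambda>\<omega>. (cmod (f \<omega> + g \<omega>))\<^sup>2)"
  proof (rule Bochner_Integration.integrable_bound)
    show "integrable M (\<lambda>\<omega>. 2 * (cmod (f \<omega>))\<^sup>2 + 2 * (cmod (g \<omega>))\<^sup>2)"
      using assms by (simp add: square_integrable_def)
    show "(\<lambda>\<omega>. (cmod (f \<omega> + g \<omega>))\<^sup>2) \<in> borel_measurable M" using meas by measurable
    show "AE \<omega> in M. norm ((cmod (f \<omega> + g \<omega>))\<^sup>2)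
        \<le> norm (2 * (cmod (f \<omega>))\<^sup>2 + 2 * (cmod (g \<omega>))\<^sup>2)"
    proof (intro AE_I2)
      fix \<omega>
      have "(cmod (f \<omega> + g \<omega>))\<^sup>2 \<le> (cmod (f \<omega>) + cmod (g \<omega>))\<^sup>2"
        by (intro power_mono norm_triangle_ineq norm_ge_zero)
      also have "\<dots> \<le> 2 * (cmod (f \<omega>))\<^sup>2 + 2 * (cmod (g \<omega>))\<^sup>2"
        using sum_squares_bound[of "cmod (f \<omega>)" "cmod (g \<omega>)"] by (simp add: power2_sum)
      finally show "norm ((cmod (f \<omega> + g \<omega>))\<^sup>2)
          \<le> norm (2 * (cmod (f \<omega>))\<^sup>2 + 2 * (cmod (g \<omega>))\<^sup>2)" by simp
    qed
  qed
qed

lemma square_integrable_sum: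
  assumes "\<And>i. i \<in> A \<Longrightarrow> square_integrable M (f i)"
  shows "square_integrable M (\<lambda>\<omega>. \<Sum>i\<in>A. f i \<omega>)"
  using assms
  by (induction A rule: infinite_finite_induct)
    (simp_all add: square_integrable_zero square_integrable_add)

lemma (in finite_measure) square_integrable_integrable:
  assumes "square_integrable M f"
  shows "integrable M f"
proof -
  have "square_integrable M (\<lambda>_. 1)" by (simp add: square_integrable_def)
  from square_integrable_cnj_mult[OF this assms] show ?thesis by simp
qed

section \<open>Second-moment matrices of square-integrable random matrices\<close>

definition matrix_square_integrable :: "'a measure \<Rightarrow> ('a \<Rightarrow> complex^'m^'n) \<Rightarrow> bool" where
  "matrix_square_integrable M X \<longleftrightarrow> (\<forall>i j. square_integrable M (\<lambda>\<omega>. X \<omega> $ i $ j))"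

lemma matrix_square_integrable_add:
  assumes "matrix_square_integrable M X" "matrix_square_integrable M Y"
  shows "matrix_square_integrable M (\<lambda>\<omega>. X \<omega> + Y \<omega>)"
  using assms by (simp add: matrix_square_integrable_def square_integrable_add)

lemma matrix_square_integrable_mult:
  assumes "matrix_square_integrable M X"
  shows "matrix_square_integrable M (\<lambda>\<omega>. X \<omega> ** A)"
  using assms unfolding matrix_square_integrable_def matrix_matrix_mult_def
  by (auto simp: mult.commute[of _ "A $ _ $ _"] intro!: square_integrable_sum square_integrable_cmult)

lemma matrix_square_integrable_diff:
  assumes "matrix_square_integrable M X" "matrix_square_integrable M Y"
  shows "matrix_square_integrable M (\<lambda>\<omega>. X \<omega> - Y \<omega>)"
  using assms square_integrable_add[OF _ square_integrable_cmult[where z = "- 1"]]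
  by (fastforce simp: matrix_square_integrable_def)

lemma (in finite_measure) integrable_matrix_square_integrable:
  assumes "matrix_square_integrable M X"
  shows "integrable M X"
  using assms
  by (intro integrable_matrix square_integrable_integrable) (simp add: matrix_square_integrable_def)

lemma integrable_gram:
  assumes "matrix_square_integrable M X" "matrix_square_integrable M Y"
  shows "integrable M (\<lambda>\<omega>. ctranspose (X \<omega>) ** Y \<omega>)"
  using assms
  by (intro integrable_matrix)
    (auto simp: matrix_square_integrable_def matrix_matrix_mult_def
      intro!: Bochner_Integration.integrable_sum square_integrable_cnj_mult)

lemma integral_gram_row:
  fixes X :: "'a \<Rightarrow> complex^'m^1" and Y :: "'a \<Rightarrow> complex^'k^1"
  assumes "matrix_square_integrable M X" "matrix_square_integrable M Y"
  shows "(\<integral>\<omega>. ctranspose (X \<omega>) ** Y \<omega> \<partial>M) $ i $ j =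
    (\<integral>\<omega>. cnj (X \<omega> $ 1 $ i) * Y \<omega> $ 1 $ j \<partial>M)"
proof -
  have "(\<integral>\<omega>. ctranspose (X \<omega>) ** Y \<omega> \<partial>M) $ i $ j =
      (\<integral>\<omega>. (ctranspose (X \<omega>) ** Y \<omega>) $ i $ j \<partial>M)"
    using assms
    by (intro integrable_matrix)
      (auto simp: matrix_square_integrable_def matrix_matrix_mult_def
        intro!: Bochner_Integration.integrable_sum square_integrable_cnj_mult)
  then show ?thesis by (simp add: matrix_matrix_mult_def)
qed

lemma integral_gram_mult:
  assumes "matrix_square_integrable M X" "matrix_square_integrable M Y"
  shows "(\<integral>\<omega>. ctranspose (X \<omega> ** A) ** (Y \<omega> ** B) \<partial>M) =
    ctranspose A ** (\<integral>\<omega>. ctranspose (X \<omega>) ** Y \<omega> \<partial>M) ** B"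
proof -
  have "ctranspose (X \<omega> ** A) ** (Y \<omega> ** B) = ctranspose A ** (ctranspose (X \<omega>) ** Y \<omega>) ** B"
    for \<omega>
    by (simp add: ctranspose_mult matrix_mul_assoc)
  then show ?thesis
    using integral_bounded_linear[OF bounded_linear_matrix_sandwich integrable_gram[OF assms]]
    by simp
qed

lemma integral_norm_square:
  fixes X :: "'a \<Rightarrow> complex^'m^'n"
  assumes "matrix_square_integrable M X"
  shows "(\<integral>\<omega>. (norm (X \<omega>))\<^sup>2 \<partial>M) = Re (trace (\<integral>\<omega>. ctranspose (X \<omega>) ** X \<omega> \<partial>M))"
proof -
  have "linear (\<lambda>Z::complex^'m^'m. Re (trace Z))"
    by (rule linearI) (simp_all add: trace_def sum.distrib sum_distrib_left)
  then have "bounded_linear (\<lambda>Z::complex^'m^'m. Re (trace Z))"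
    by (simp add: linear_conv_bounded_linear)
  from integral_bounded_linear[OF this integrable_gram[OF assms assms]]
  show ?thesis by (simp add: norm_matrix_square)
qed

lemma integral_ctranspose:
  fixes X :: "'a \<Rightarrow> complex^'m^'n"
  assumes "integrable M X"
  shows "(\<integral>\<omega>. ctranspose (X \<omega>) \<partial>M) = ctranspose (\<integral>\<omega>. X \<omega> \<partial>M)"
proof -
  have "linear (ctranspose :: complex^'m^'n \<Rightarrow> _)"
    by (rule linearI) (simp_all add: ctranspose_add vec_eq_iff)
  then show ?thesis
    using integral_bounded_linear[OF _ assms, of ctranspose] by (simp add: linear_conv_bounded_linear)
qed

subsection \<open>White random matrices\<close>

lemma (in prob_space) normal_moments:
  assumes X: "distributed M lborel X (\<lambda>x. ennreal (normal_density 0 s x))" and s: "0 < s"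
  shows "integrable M X" "(\<integral>\<omega>. X \<omega> \<partial>M) = 0"
    "integrable M (\<lambda>\<omega>. (X \<omega>)\<^sup>2)" "(\<integral>\<omega>. (X \<omega>)\<^sup>2 \<partial>M) = s\<^sup>2"
proof -
  show "integrable M X"
    using distributed_integrable[OF X, of "\<lambda>x. x"] integrable_normal_moment_nz_1[OF s, of 0]
    by simp
  show mean: "(\<integral>\<omega>. X \<omega> \<partial>M) = 0"
    by (rule normal_distributed_expectation[OF s X])
  show "integrable M (\<lambda>\<omega>. (X \<omega>)\<^sup>2)"
    using distributed_integrable[OF X, of "\<lambda>x. x\<^sup>2"] integrable_normal_moment[OF s, of 0 2]
    by simp
  show "(\<integral>\<omega>. (X \<omega>)\<^sup>2 \<partial>M) = s\<^sup>2"
    using normal_distributed_variance[OF s X] mean by simp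
qed

text \<open>The real and imaginary parts each contribute variance \<open>v / 2\<close> to the second
  absolute moment.\<close>

lemma (in prob_space) complex_gaussian_moments:
  assumes Z: "complex_gaussian M v Z" and v: "0 < v"
  shows "square_integrable M Z" "(\<integral>\<omega>. Z \<omega> \<partial>M) = 0"
    "(\<integral>\<omega>. cnj (Z \<omega>) * Z \<omega> \<partial>M) = of_real v"
proof -
  have s: "0 < sqrt (v / 2)" using v by simp
  have dRe: "distributed M lborel (\<lambda>\<omega>. Re (Z \<omega>)) (\<lambda>x. ennreal (normal_density 0 (sqrt (v / 2)) x))"
    and dIm: "distributed M lborel (\<lambda>\<omega>. Im (Z \<omega>)) (\<lambda>x. ennreal (normal_density 0 (sqrt (v / 2)) x))"
    using Z by (auto simp: complex_gaussian_def)
  note re = normal_moments[OF dRe s] and im = normal_moments[OF dIm s]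
  have Zeq: "Z = (\<lambda>\<omega>. complex_of_real (Re (Z \<omega>)) + \<i> * complex_of_real (Im (Z \<omega>)))"
    by (simp add: complex_eq_iff fun_eq_iff)
  have int: "has_bochner_integral M (\<lambda>\<omega>. complex_of_real (Re (Z \<omega>)) + \<i> * complex_of_real (Im (Z \<omega>)))
      (complex_of_real 0 + \<i> * complex_of_real 0)"
    using re(1,2) im(1,2)
    by (intro has_bochner_integral_add has_bochner_integral_mult_right has_bochner_integral_of_real)
      (simp_all add: has_bochner_integral_iff)
  then show "(\<integral>\<omega>. Z \<omega> \<partial>M) = 0"
    by (subst Zeq) (simp add: has_bochner_integral_iff)
  have Zmeas: "Z \<in> borel_measurable M"
    by (subst Zeq) (rule borel_measurable_has_bochner_integral[OF int])
  have abs: "has_bochner_integral M (\<lambda>\<omega>. (cmod (Z \<omega>))\<^sup>2) v"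
    unfolding cmod_power2
    using has_bochner_integral_add[of M _ "v / 2" _ "v / 2"] re(3,4) im(3,4) v
    by (simp add: has_bochner_integral_iff)
  then show "square_integrable M Z"
    using Zmeas by (simp add: square_integrable_def has_bochner_integral_iff)
  have "cnj z * z = complex_of_real ((cmod z)\<^sup>2)" for z
    by (simp only: complex_norm_square mult.commute)
  then show "(\<integral>\<omega>. cnj (Z \<omega>) * Z \<omega> \<partial>M) = of_real v"
    using abs by (simp only: integral_complex_of_real has_bochner_integral_iff)
qed

section \<open>Independence and moments of products\<close>

lemma (in prob_space) indep_vars_imp_indep_var:
  assumes "indep_vars N X I" "i \<in> I" "j \<in> I" "i \<noteq> j"
  shows "indep_var (N i) (X i) (N j) (X j)"
proof -
  \<comment> \<open>Disjoint singleton blocks of the family are independent as product-valued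
    variables; projecting each block to its only coordinate gives the pair.\<close>
  have "indep_var (PiM {i} N) (\<lambda>\<omega>. restrict (\<lambda>i. X i \<omega>) {i})
      (PiM {j} N) (\<lambda>\<omega>. restrict (\<lambda>i. X i \<omega>) {j})"
    using assms by (intro indep_var_restrict) auto
  then have "indep_var (N i) ((\<lambda>f. f i) \<circ> (\<lambda>\<omega>. restrict (\<lambda>i. X i \<omega>) {i}))
      (N j) ((\<lambda>f. f j) \<circ> (\<lambda>\<omega>. restrict (\<lambda>i. X i \<omega>) {j}))"
    by (rule indep_var_compose) (auto intro: measurable_component_singleton)
  then show ?thesis by (simp add: o_def)
qed

lemma (in prob_space) indep_var_cnj_mult:
  assumes ind: "indep_var borel f borel g"
    and f: "square_integrable M f" and g: "square_integrable M g"
  shows "(\<integral>\<omega>. cnj (f \<omega>) * g \<omega> \<partial>M) = cnj (\<integral>\<omega>. f \<omega> \<partial>M) * (\<integral>\<omega>. g \<omega> \<partial>M)"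
proof -
  have "cnj \<in> borel_measurable borel"
    by (intro borel_measurable_continuous_onI continuous_intros)
  then have "indep_var borel (cnj \<circ> f) borel (id \<circ> g)"
    by (intro indep_var_compose[OF ind]) simp_all
  then have "indep_var borel (\<lambda>\<omega>. cnj (f \<omega>)) borel g" by (simp add: o_def)
  then have "(\<integral>\<omega>. cnj (f \<omega>) * g \<omega> \<partial>M) = (\<integral>\<omega>. cnj (f \<omega>) \<partial>M) * (\<integral>\<omega>. g \<omega> \<partial>M)"
    using f g by (intro indep_var_lebesgue_integral) (simp_all add: square_integrable_integrable)
  then show ?thesis by simp
qed

text \<open>The squared moduli are independent and integrable, so their product is integrable.
  Without independence, square integrability of the factors gives only integrability of the
  product.\<close>

lemma (in prob_space) indep_var_square_integrable_mult:
  assumes ind: "indep_var borel f borel g"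
    and f: "square_integrable M f" and g: "square_integrable M g"
  shows "square_integrable M (\<lambda>\<omega>. f \<omega> * g \<omega>)"
proof -
  have "indep_var borel ((\<lambda>z. (cmod z)\<^sup>2) \<circ> f) borel ((\<lambda>z. (cmod z)\<^sup>2) \<circ> g)"
    by (rule indep_var_compose[OF ind]) simp_all
  then have "indep_var borel (\<lambda>\<omega>. (cmod (f \<omega>))\<^sup>2) borel (\<lambda>\<omega>. (cmod (g \<omega>))\<^sup>2)"
    by (simp add: o_def)
  then have "integrable M (\<lambda>\<omega>. (cmod (f \<omega>))\<^sup>2 * (cmod (g \<omega>))\<^sup>2)"
    using f g by (intro indep_var_integrable) (simp_all add: square_integrable_def)
  moreover have "(\<lambda>\<omega>. f \<omega> * g \<omega>) \<in> borel_measurable M"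
    using f g by (intro borel_measurable_times) (simp_all add: square_integrable_def)
  ultimately show ?thesis by (simp add: square_integrable_def norm_mult power_mult_distrib)
qed

text \<open>A preimage under a composition is a preimage under the inner map, so composing only
  shrinks the two families of events, and independence passes to subfamilies.\<close>

lemma (in prob_space) indep_elements_compose:
  assumes "indep_elements M X Y" "f \<in> borel_measurable borel" "g \<in> borel_measurable borel"
  shows "indep_elements M (\<lambda>\<omega>. f (X \<omega>)) (\<lambda>\<omega>. g (Y \<omega>))"
proof -
  have X: "X \<in> borel_measurable M" and Y: "Y \<in> borel_measurable M"
    and ind: "indep_set {X -` A \<inter> space M | A. A \<in> sets borel} {Y -` B \<inter> space M | B. B \<in> sets borel}"
    using assms(1) by (auto simp: indep_elements_def)
  have vimage: "{(\<lambda>\<omega>. h (Z \<omega>)) -` A \<inter> space M | A. A \<in> sets borel}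
      \<subseteq> {Z -` A \<inter> space M | A. A \<in> sets borel}"
    if "h \<in> borel_measurable borel"
    for h :: "'x::topological_space \<Rightarrow> 'y::topological_space" and Z
  proof clarify
    fix A :: "'y set" assume "A \<in> sets borel"
    then have "h -` A \<in> sets borel" using measurable_sets[OF that, of A] by simp
    then show "\<exists>B. (\<lambda>\<omega>. h (Z \<omega>)) -` A \<inter> space M = Z -` B \<inter> space M \<and> B \<in> sets borel"
      by (intro exI[of _ "h -` A"]) auto
  qed
  show ?thesis
    unfolding indep_elements_def
  proof (intro conjI)
    show "(\<lambda>\<omega>. f (X \<omega>)) \<in> borel_measurable M" "(\<lambda>\<omega>. g (Y \<omega>)) \<in> borel_measurable M"
      using measurable_compose X Y assms by blast+
    show "indep_set {(\<lambda>\<omega>. f (X \<omega>)) -` A \<inter> space M | A. A \<in> sets borel}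
        {(\<lambda>\<omega>. g (Y \<omega>)) -` B \<inter> space M | B. B \<in> sets borel}"
      unfolding indep_set_def
      by (rule indep_sets_mono_sets[OF ind[unfolded indep_set_def]])
        (use vimage[OF assms(2), of X] vimage[OF assms(3), of Y] in \<open>simp split: bool.split\<close>)
  qed
qed

text \<open>Gives access to the product rules for \<open>indep_var\<close> once both variables are
  scalar. The families of preimages are stable under intersection, so their independence extends to
  the generated sigma-algebras.\<close>

lemma (in prob_space) indep_elements_indep_var:
  fixes f g :: "'a \<Rightarrow> complex"
  assumes "indep_elements M f g"
  shows "indep_var borel f borel g"
proof -
  have f: "f \<in> borel_measurable M" and g: "g \<in> borel_measurable M"
    and ind: "indep_set {f -` A \<inter> space M | A. A \<in> sets borel} {g -` B \<inter> space M | B. B \<in> sets borel}"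
    using assms by (auto simp: indep_elements_def)
  have "Int_stable {f -` A \<inter> space M | A. A \<in> sets borel}" for f :: "'a \<Rightarrow> complex"
  proof (rule Int_stableI, clarify)
    fix A B :: "complex set" assume "A \<in> sets borel" "B \<in> sets borel"
    then show "\<exists>C. (f -` A \<inter> space M) \<inter> (f -` B \<inter> space M) = f -` C \<inter> space M \<and> C \<in> sets borel"
      by (intro exI[of _ "A \<inter> B"]) auto
  qed
  then show ?thesis
    unfolding indep_var_eq using f g indep_set_sigma_sets[OF ind] by blast
qed

text \<open>All that is used of the Gaussian matrices.\<close>

definition white :: "'a measure \<Rightarrow> real \<Rightarrow> ('a \<Rightarrow> complex^'m^'n) \<Rightarrow> bool" where
  "white M v X \<longleftrightarrow> matrix_square_integrable M X \<and>
     (\<forall>i j. (\<integral>\<omega>. X \<omega> $ i $ j \<partial>M) = 0) \<and>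
     (\<forall>i j k l. (\<integral>\<omega>. cnj (X \<omega> $ i $ j) * X \<omega> $ k $ l \<partial>M) =
        (if i = k \<and> j = l then of_real v else 0))"

text \<open>Cross moments of distinct entries factor into means, which are zero.\<close>

lemma (in prob_space) iid_complex_gaussian_white:
  assumes X: "iid_complex_gaussian M v X" and v: "0 < v"
  shows "white M v X"
proof -
  have g: "complex_gaussian M v (\<lambda>\<omega>. X \<omega> $ i $ j)" for i j
    using X by (simp add: iid_complex_gaussian_def)
  note mom = complex_gaussian_moments[OF g v]
  have zero: "(\<integral>\<omega>. cnj (X \<omega> $ i $ j) * X \<omega> $ k $ l \<partial>M) = 0" if ne: "(i, j) \<noteq> (k, l)" for i j k l
  proof -
    have "indep_var borel ((\<lambda>(i, j) \<omega>. X \<omega> $ i $ j) (i, j)) borel ((\<lambda>(i, j) \<omega>. X \<omega> $ i $ j) (k, l))"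
      using X ne by (intro indep_vars_imp_indep_var) (auto simp: iid_complex_gaussian_def)
    then show ?thesis
      using indep_var_cnj_mult[of "\<lambda>\<omega>. X \<omega> $ i $ j" "\<lambda>\<omega>. X \<omega> $ k $ l"] mom by simp
  qed
  show ?thesis
    unfolding white_def matrix_square_integrable_def using mom zero by auto
qed

lemma (in finite_measure) integral_matrix_nth:
  assumes "matrix_square_integrable M X"
  shows "(\<integral>\<omega>. X \<omega> \<partial>M) $ i $ j = (\<integral>\<omega>. X \<omega> $ i $ j \<partial>M)"
  using assms unfolding matrix_square_integrable_def
  by (intro integrable_matrix(2) square_integrable_integrable) blast

lemma (in finite_measure) white_integral:
  assumes "white M v X"
  shows "(\<integral>\<omega>. X \<omega> \<partial>M) = 0"
proof -
  have "(\<integral>\<omega>. X \<omega> \<partial>M) $ i $ j = 0" for i j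
    using assms integral_matrix_nth[of X i j] by (simp add: white_def)
  then show ?thesis by (simp add: vec_eq_iff)
qed

lemma white_row_gram:
  fixes X :: "'a \<Rightarrow> complex^'m^1"
  assumes "white M v X"
  shows "(\<integral>\<omega>. ctranspose (X \<omega>) ** X \<omega> \<partial>M) = mat (of_real v)"
  using assms by (simp add: vec_eq_iff white_def integral_gram_row mat_def)

text \<open>Entry \<open>(a, b)\<close> of the second moment is a double sum over \<open>i\<close>,
  \<open>j\<close> of a cross moment of \<open>X\<close> times one of \<open>Y\<close>. Whiteness of
  \<open>X\<close> keeps only \<open>i = j\<close> and \<open>a = b\<close>, so the matrix is
  diagonal and each diagonal entry is the sum of the second moments of the entries of
  \<open>Y\<close>, a trace.\<close>

lemma (in prob_space) indep_white_mult:
  fixes X :: "'a \<Rightarrow> complex^'m^'n" and Y :: "'a \<Rightarrow> complex^'n^1"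
  assumes ind: "indep_elements M X Y" and X: "white M 1 X" and Y: "matrix_square_integrable M Y"
  shows "matrix_square_integrable M (\<lambda>\<omega>. Y \<omega> ** X \<omega>)"
    and "(\<integral>\<omega>. Y \<omega> ** X \<omega> \<partial>M) = 0"
    and "(\<integral>\<omega>. ctranspose (Y \<omega> ** X \<omega>) ** (Y \<omega> ** X \<omega>) \<partial>M) =
      mat (trace (\<integral>\<omega>. ctranspose (Y \<omega>) ** Y \<omega> \<partial>M))"
proof -
  have sqX: "square_integrable M (\<lambda>\<omega>. X \<omega> $ i $ j)" for i j
    using X by (simp add: white_def matrix_square_integrable_def)
  have sqY: "square_integrable M (\<lambda>\<omega>. Y \<omega> $ 1 $ i)" for i
    using Y by (simp add: matrix_square_integrable_def)
  have indXY: "indep_var borel (\<lambda>\<omega>. f (X \<omega>)) borel (\<lambda>\<omega>. g (Y \<omega>))"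
    if "f \<in> borel_measurable borel" "g \<in> borel_measurable borel" for f g :: "_ \<Rightarrow> complex"
    by (rule indep_elements_indep_var[OF indep_elements_compose[OF ind that]])
  have sqYX: "square_integrable M (\<lambda>\<omega>. Y \<omega> $ 1 $ i * X \<omega> $ i $ j)" for i j
    using indep_var_square_integrable_mult[OF indXY sqX sqY, OF borel_measurable_matrix_nth
        borel_measurable_matrix_nth]
    by (simp add: mult.commute)
  show sq: "matrix_square_integrable M (\<lambda>\<omega>. Y \<omega> ** X \<omega>)"
    unfolding matrix_square_integrable_def matrix_matrix_mult_def
    using sqYX by (auto simp: forall_1 intro!: square_integrable_sum)
  have "(\<integral>\<omega>. X \<omega> $ i $ j * Y \<omega> $ 1 $ i \<partial>M) = 0" for i j
    using indep_var_lebesgue_integral[OF indXY[OF borel_measurable_matrix_nth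
        borel_measurable_matrix_nth] square_integrable_integrable[OF sqX]
        square_integrable_integrable[OF sqY]] X
    by (simp add: white_def)
  then have "(\<integral>\<omega>. Y \<omega> $ 1 $ i * X \<omega> $ i $ j \<partial>M) = 0" for i j
    by (simp add: mult.commute)
  then have "(\<integral>\<omega>. Y \<omega> ** X \<omega> \<partial>M) $ 1 $ j = 0" for j
    unfolding integral_matrix_nth[OF sq]
    using square_integrable_integrable[OF sqYX] by (simp add: matrix_matrix_mult_def)
  then show "(\<integral>\<omega>. Y \<omega> ** X \<omega> \<partial>M) = 0"
    by (simp add: vec_eq_iff forall_1)
  \<comment> \<open>Independence holds between the whole matrices, hence between products of two
    entries of each. This yields both integrability and factorization of the fourfold product
    \<open>?t\<close>.\<close>
  have prodX: "(\<lambda>A::complex^'m^'n. cnj (A $ i $ a) * A $ j $ b) \<in> borel_measurable borel" for i j a b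
    by (intro borel_measurable_continuous_onI continuous_intros)
  have prodY: "(\<lambda>A::complex^'n^1. cnj (A $ 1 $ i) * A $ 1 $ j) \<in> borel_measurable borel" for i j
    by (intro borel_measurable_continuous_onI continuous_intros)
  let ?t = "\<lambda>i j a b \<omega>. (cnj (X \<omega> $ i $ a) * X \<omega> $ j $ b) * (cnj (Y \<omega> $ 1 $ i) * Y \<omega> $ 1 $ j)"
  have int: "integrable M (?t i j a b)"
    and val: "(\<integral>\<omega>. ?t i j a b \<omega> \<partial>M) =
      (if i = j \<and> a = b then \<integral>\<omega>. cnj (Y \<omega> $ 1 $ i) * Y \<omega> $ 1 $ i \<partial>M else 0)" for i j a b
    using indep_var_integrable[OF indXY[OF prodX prodY] square_integrable_cnj_mult[OF sqX sqX]
        square_integrable_cnj_mult[OF sqY sqY]]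
      indep_var_lebesgue_integral[OF indXY[OF prodX prodY] square_integrable_cnj_mult[OF sqX sqX]
        square_integrable_cnj_mult[OF sqY sqY]] X
    by (simp_all add: white_def)
  show "(\<integral>\<omega>. ctranspose (Y \<omega> ** X \<omega>) ** (Y \<omega> ** X \<omega>) \<partial>M) =
      mat (trace (\<integral>\<omega>. ctranspose (Y \<omega>) ** Y \<omega> \<partial>M))"
  proof -
    have "(\<integral>\<omega>. ctranspose (Y \<omega> ** X \<omega>) ** (Y \<omega> ** X \<omega>) \<partial>M) $ a $ b =
        mat (trace (\<integral>\<omega>. ctranspose (Y \<omega>) ** Y \<omega> \<partial>M)) $ a $ b" for a b
    proof -
      have "(\<integral>\<omega>. ctranspose (Y \<omega> ** X \<omega>) ** (Y \<omega> ** X \<omega>) \<partial>M) $ a $ b =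
          (\<integral>\<omega>. (\<Sum>i\<in>UNIV. \<Sum>j\<in>UNIV. ?t i j a b \<omega>) \<partial>M)"
        unfolding integral_gram_row[OF sq sq]
        by (simp add: matrix_matrix_mult_def sum_product) (simp add: mult_ac)
      also have "\<dots> = (\<Sum>i\<in>UNIV. \<Sum>j\<in>UNIV. \<integral>\<omega>. ?t i j a b \<omega> \<partial>M)"
        by (simp only: Bochner_Integration.integral_sum Bochner_Integration.integrable_sum int)
      also have "\<dots> = (\<Sum>i\<in>UNIV. \<Sum>j\<in>UNIV. if i = j then
          if a = b then \<integral>\<omega>. cnj (Y \<omega> $ 1 $ i) * Y \<omega> $ 1 $ i \<partial>M else 0 else 0)"
        unfolding val by (intro sum.cong refl) simp
      also have "\<dots> = (\<Sum>i\<in>UNIV. if a = b then \<integral>\<omega>. cnj (Y \<omega> $ 1 $ i) * Y \<omega> $ 1 $ i \<partial>M else 0)"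
        by simp
      also have "\<dots> = mat (trace (\<integral>\<omega>. ctranspose (Y \<omega>) ** Y \<omega> \<partial>M)) $ a $ b"
        by (simp add: mat_def trace_def integral_gram_row[OF Y Y])
      finally show ?thesis .
    qed
    then show ?thesis by (simp add: vec_eq_iff)
  qed
qed

subsection \<open>The LMMSE estimate in white noise\<close>

lemma matrix_mult_add_left: "(A + B) ** C = A ** C + B ** C"
  for A B :: "complex^'n^'m" and C :: "complex^'k^'n"
  by (simp add: vec_eq_iff matrix_matrix_mult_def algebra_simps sum.distrib)

lemma matrix_mult_diff_left: "(A - B) ** C = A ** C - B ** C"
  for A B :: "complex^'n^'m" and C :: "complex^'k^'n"
  by (simp add: vec_eq_iff matrix_matrix_mult_def algebra_simps sum_subtractf)

lemma matrix_mult_diff_right: "A ** (B - C) = A ** B - A ** C"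
  for A :: "complex^'n^'m" and B C :: "complex^'k^'n"
  by (simp add: vec_eq_iff matrix_matrix_mult_def algebra_simps sum_subtractf)

lemma matrix_mult_zero_complex [simp]:
  "(0::complex^'n^'m) ** (B::complex^'k^'n) = 0" "(A::complex^'n^'m) ** (0::complex^'k^'n) = 0"
  by (simp_all add: vec_eq_iff matrix_matrix_mult_def)

lemma ctranspose_zero [simp]: "ctranspose 0 = 0"
  by (simp add: vec_eq_iff)

lemma ctranspose_mat: "ctranspose (mat z) = mat (cnj z)"
  by (simp add: vec_eq_iff mat_def)

lemma mat_mult_component [simp]: "(mat z ** A) $ i $ j = z * A $ i $ j"
  for A :: "complex^'m^'n"
  by (simp add: matrix_matrix_mult_def mat_def if_distrib[of "\<lambda>x. x * _"] cong: if_cong)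

lemma mat_commute: "A ** mat z = mat z ** A" for A :: "complex^'m^'m"
  by (simp add: vec_eq_iff)
    (simp add: matrix_matrix_mult_def mat_def if_distrib if_distribR mult.commute cong: if_cong)

section \<open>Sesquilinearity of the cross second moment\<close>

lemma integral_gram_diff_left:
  assumes "matrix_square_integrable M X" "matrix_square_integrable M Y" "matrix_square_integrable M Z"
  shows "(\<integral>\<omega>. ctranspose (X \<omega> - Y \<omega>) ** Z \<omega> \<partial>M) =
    (\<integral>\<omega>. ctranspose (X \<omega>) ** Z \<omega> \<partial>M) - (\<integral>\<omega>. ctranspose (Y \<omega>) ** Z \<omega> \<partial>M)"
  using assms
  by (simp add: ctranspose_diff matrix_mult_diff_left integrable_gram Bochner_Integration.integral_diff)

lemma integral_gram_swap:
  assumes "matrix_square_integrable M X" "matrix_square_integrable M Y"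
  shows "(\<integral>\<omega>. ctranspose (Y \<omega>) ** X \<omega> \<partial>M) = ctranspose (\<integral>\<omega>. ctranspose (X \<omega>) ** Y \<omega> \<partial>M)"
  using integral_ctranspose[OF integrable_gram[OF assms]] by (simp add: ctranspose_mult)

lemma integral_gram_diff_right:
  assumes "matrix_square_integrable M X" "matrix_square_integrable M Y" "matrix_square_integrable M Z"
  shows "(\<integral>\<omega>. ctranspose (Z \<omega>) ** (X \<omega> - Y \<omega>) \<partial>M) =
    (\<integral>\<omega>. ctranspose (Z \<omega>) ** X \<omega> \<partial>M) - (\<integral>\<omega>. ctranspose (Z \<omega>) ** Y \<omega> \<partial>M)"
  using assms
  by (simp add: matrix_mult_diff_right integrable_gram Bochner_Integration.integral_diff)

lemma integral_gram_add_left: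
  assumes "matrix_square_integrable M X" "matrix_square_integrable M Y" "matrix_square_integrable M Z"
  shows "(\<integral>\<omega>. ctranspose (X \<omega> + Y \<omega>) ** Z \<omega> \<partial>M) =
    (\<integral>\<omega>. ctranspose (X \<omega>) ** Z \<omega> \<partial>M) + (\<integral>\<omega>. ctranspose (Y \<omega>) ** Z \<omega> \<partial>M)"
  using assms
  by (simp add: ctranspose_add matrix_mult_add_left integrable_gram Bochner_Integration.integral_add)

lemma integral_mult_right_matrix:
  fixes X :: "'a \<Rightarrow> complex^'m^'n" and A :: "complex^'k^'m"
  assumes "integrable M X"
  shows "(\<integral>\<omega>. X \<omega> ** A \<partial>M) = (\<integral>\<omega>. X \<omega> \<partial>M) ** A"
  using integral_bounded_linear[OF bounded_linear_matrix_sandwich[of "mat 1" A] assms] by simp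

lemma matrix_inv_mult:
  assumes "invertible A"
  shows "A ** matrix_inv A = mat 1" "matrix_inv A ** A = mat 1"
  using someI_ex[OF assms[unfolded invertible_def]] by (simp_all add: matrix_inv_def)

text \<open>Coercivity makes the kernel trivial, which suffices for a square matrix. The bound is
  phrased with matrices \<open>W\<close> because the excess mean-square error has that form.\<close>

lemma invertible_if_coercive:
  fixes S :: "complex^'m^'m"
  assumes v: "0 < v"
    and coercive: "\<And>W::complex^'m^'m. v * (norm W)\<^sup>2 \<le> Re (trace (ctranspose W ** S ** W))"
  shows "invertible S"
proof -
  have "x = 0" if "S *v x = 0" for x
  proof -
    \<comment> \<open>All columns are \<open>x\<close>, so the matrix bound can be applied to a
      kernel vector.\<close>
    define W :: "complex^'m^'m" where "W = (\<chi> i j. x $ i)"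
    have "S ** W = 0"
      using that by (simp add: W_def vec_eq_iff matrix_matrix_mult_def matrix_vector_mult_def)
    then have "v * (norm W)\<^sup>2 \<le> 0"
      using coercive[of W] by (simp add: matrix_mul_assoc[symmetric] trace_def)
    then have "W = 0" using v by (simp add: mult_le_0_iff)
    then show "x = 0" by (simp add: W_def vec_eq_iff)
  qed
  then have "\<exists>B. B ** S = mat 1" by (simp add: matrix_left_invertible_ker)
  then show ?thesis by (simp add: invertible_left_inverse)
qed

text \<open>The orthogonality principle followed by completing the square. Signal and noise enter
  through first and second moments only, so being uncorrelated takes the place of
  independence.\<close>

lemma (in prob_space) lmmse_white_noise:
  fixes u n r :: "'a \<Rightarrow> complex^'m^1"
  assumes u: "matrix_square_integrable M u" "(\<integral>\<omega>. u \<omega> \<partial>M) = 0"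
    and n: "white M v n" and v: "0 < v"
    and uncorrelated: "(\<integral>\<omega>. ctranspose (u \<omega>) ** n \<omega> \<partial>M) = 0"
    and r: "\<And>\<omega>. r \<omega> = u \<omega> + n \<omega>"
    and R: "R = (\<integral>\<omega>. ctranspose (u \<omega>) ** u \<omega> \<partial>M)"
    and Q: "Q = matrix_inv (R + mat (of_real v))"
  shows "zero_mean_with_cov M (lmmse_estimate M u r) (R ** Q ** R)"
    and "zero_mean_with_cov M (\<lambda>\<omega>. u \<omega> - lmmse_estimate M u r \<omega>) (R - R ** Q ** R)"
proof -
  define S where "S = R + mat (of_real v)"
  \<comment> \<open>The cross second moment; its values on \<open>u\<close>, \<open>n\<close> and
    \<open>r\<close> determine every covariance below.\<close>
  define C :: "('a \<Rightarrow> complex^'m^1) \<Rightarrow> ('a \<Rightarrow> complex^'m^1) \<Rightarrow> complex^'m^'m" where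
    "C X Y = (\<integral>\<omega>. ctranspose (X \<omega>) ** Y \<omega> \<partial>M)" for X Y
  have sn: "matrix_square_integrable M n" using n by (simp add: white_def)
  have req: "r = (\<lambda>\<omega>. u \<omega> + n \<omega>)" using r by auto
  have sr: "matrix_square_integrable M r"
    unfolding req by (intro matrix_square_integrable_add u sn)
  have Cuu: "C u u = R" by (simp add: C_def R)
  have hR: "ctranspose R = R" using integral_gram_swap[OF u(1) u(1)] by (simp add: R)
  have hS: "ctranspose S = S" by (simp add: S_def ctranspose_add ctranspose_mat hR)
  have Cnu: "C n u = 0" using integral_gram_swap[OF u(1) sn] uncorrelated by (simp add: C_def)
  have Cru: "C r u = R"
    using integral_gram_add_left[OF u(1) sn u(1)] Cnu Cuu by (simp add: C_def req)
  have Cur: "C u r = R" using integral_gram_swap[OF sr u(1)] Cru by (simp add: C_def hR)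
  have Crn: "C r n = mat (of_real v)"
    using integral_gram_add_left[OF u(1) sn sn] uncorrelated white_row_gram[OF n]
    by (simp add: C_def req)
  have Cnr: "C n r = mat (of_real v)"
    using integral_gram_swap[OF sr sn] Crn by (simp add: C_def ctranspose_mat)
  have Crr: "C r r = S"
    using integral_gram_add_left[OF u(1) sn sr] Cur Cnr by (simp add: C_def req S_def)
  have gram: "C (\<lambda>\<omega>. X \<omega> ** A) (\<lambda>\<omega>. Y \<omega> ** B) = ctranspose A ** C X Y ** B"
    if "matrix_square_integrable M X" "matrix_square_integrable M Y" for X Y A B
    unfolding C_def by (rule integral_gram_mult[OF that])
  \<comment> \<open>The \<open>R\<close> part of \<open>S\<close> contributes the mean square of
    \<open>u ** W\<close>, which is nonnegative; the noise part contributes exactly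
    \<open>v * (norm W)\<^sup>2\<close>.\<close>
  have coercive: "v * (norm W)\<^sup>2 \<le> Re (trace (ctranspose W ** S ** W))" for W :: "complex^'m^'m"
  proof -
    have "0 \<le> (\<integral>\<omega>. (norm (u \<omega> ** W))\<^sup>2 \<partial>M)" by simp
    also have "\<dots> = Re (trace (ctranspose W ** R ** W))"
      using integral_norm_square[OF matrix_square_integrable_mult[OF u(1), of W]]
        gram[OF u(1) u(1), of W W]
      by (simp only: C_def R)
    finally have "0 \<le> Re (trace (ctranspose W ** R ** W))" .
    moreover have "ctranspose W ** S ** W =
        ctranspose W ** R ** W + mat (of_real v) ** (ctranspose W ** W)"
      by (simp add: S_def matrix_add_ldistrib matrix_mult_add_left matrix_mul_assoc mat_commute)
    moreover have "Re (trace (mat (of_real v) ** (ctranspose W ** W))) = v * (norm W)\<^sup>2"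
      by (simp add: norm_matrix_square trace_def sum_distrib_left)
    ultimately show ?thesis by (simp add: trace_add)
  qed
  have inv: "invertible S" by (rule invertible_if_coercive[OF v coercive])
  have QS: "Q ** S = mat 1" and SQ: "S ** Q = mat 1"
    using matrix_inv_mult[OF inv] by (simp_all add: Q S_def)
  \<comment> \<open>As \<open>S\<close> is Hermitian, \<open>ctranspose Q\<close> is a left inverse
    of \<open>S\<close> and so equals the right inverse \<open>Q\<close>.\<close>
  have hQ: "ctranspose Q = Q"
  proof -
    have "ctranspose Q ** S = mat 1"
      using arg_cong[OF SQ, of ctranspose] by (simp add: ctranspose_mult hS ctranspose_mat)
    then show ?thesis
      by (metis SQ matrix_mul_assoc matrix_mul_lid matrix_mul_rid)
  qed
  \<comment> \<open>The solution of the normal equation \<open>C r r ** W = C r u\<close>, that is,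
    \<open>S ** W = R\<close>.\<close>
  define W0 where "W0 = Q ** R"
  define e where "e \<omega> = u \<omega> - r \<omega> ** W0" for \<omega>
  have SW0: "S ** W0 = R" by (simp add: W0_def matrix_mul_assoc SQ)
  have hW0: "ctranspose W0 = R ** Q" by (simp add: W0_def ctranspose_mult hQ hR)
  have srW: "matrix_square_integrable M (\<lambda>\<omega>. r \<omega> ** W)" for W :: "complex^'m^'m"
    by (rule matrix_square_integrable_mult[OF sr])
  have se: "matrix_square_integrable M e"
    unfolding e_def by (intro matrix_square_integrable_diff u srW)
  have gram1: "C r (\<lambda>\<omega>. r \<omega> ** W) = S ** W" "C u (\<lambda>\<omega>. r \<omega> ** W) = R ** W" for W
    using gram[OF sr sr, of "mat 1" W] gram[OF u(1) sr, of "mat 1" W]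
    by (simp_all add: Crr Cur ctranspose_mat)
  \<comment> \<open>Orthogonality principle: the normal equation says exactly that the residual is
    uncorrelated with \<open>r\<close>.\<close>
  have Cre: "C r e = 0"
    using integral_gram_diff_right[OF u(1) srW[of W0] sr] Cru gram1(1)[of W0]
    by (simp add: C_def e_def SW0)
  have Crwe: "C (\<lambda>\<omega>. r \<omega> ** W) e = 0" for W
    using gram[OF sr se, of W "mat 1"] by (simp add: Cre)
  have Cerw: "C e (\<lambda>\<omega>. r \<omega> ** W) = 0" for W
    using integral_gram_swap[OF srW[of W] se] Crwe[of W] by (simp add: C_def)
  have Cue: "C u e = R - R ** Q ** R"
    using integral_gram_diff_right[OF u(1) srW[of W0] u(1)] Cuu gram1(2)[of W0]
    by (simp add: C_def e_def W0_def matrix_mul_assoc)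
  \<comment> \<open>Expanding the left factor \<open>e\<close> leaves \<open>C u e\<close>, since
    the estimate is uncorrelated with \<open>e\<close>.\<close>
  have Cee: "C e e = R - R ** Q ** R"
    using integral_gram_diff_left[OF u(1) srW[of W0] se] Cue Crwe[of W0]
    by (simp add: C_def e_def[abs_def])
  \<comment> \<open>Completing the square: the error of \<open>W\<close> is \<open>e\<close> minus
    \<open>r ** (W - W0)\<close>, and both cross terms vanish.\<close>
  have mse: "(\<integral>\<omega>. (norm (u \<omega> - r \<omega> ** W))\<^sup>2 \<partial>M) =
      Re (trace (C e e)) + Re (trace (ctranspose (W - W0) ** S ** (W - W0)))" for W
  proof -
    let ?d = "\<lambda>\<omega>. r \<omega> ** (W - W0)"
    have "u \<omega> - r \<omega> ** W = e \<omega> - ?d \<omega>" for \<omega>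
      by (simp add: e_def matrix_mult_diff_right)
    then have "(\<integral>\<omega>. (norm (u \<omega> - r \<omega> ** W))\<^sup>2 \<partial>M) =
        Re (trace (C (\<lambda>\<omega>. e \<omega> - ?d \<omega>) (\<lambda>\<omega>. e \<omega> - ?d \<omega>)))"
      using integral_norm_square[OF matrix_square_integrable_diff[OF se srW[of "W - W0"]]]
      by (simp add: C_def)
    also have "C (\<lambda>\<omega>. e \<omega> - ?d \<omega>) (\<lambda>\<omega>. e \<omega> - ?d \<omega>) = C e e + C ?d ?d"
      using integral_gram_diff_left[OF se srW[of "W - W0"]
          matrix_square_integrable_diff[OF se srW[of "W - W0"]]]
        integral_gram_diff_right[OF se srW[of "W - W0"] se]
        integral_gram_diff_right[OF se srW[of "W - W0"] srW[of "W - W0"]]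
        Cerw[of "W - W0"] Crwe[of "W - W0"]
      by (simp add: C_def)
    also have "C ?d ?d = ctranspose (W - W0) ** S ** (W - W0)"
      using gram[OF sr sr] by (simp add: Crr)
    finally show ?thesis by (simp add: trace_add)
  qed
  \<comment> \<open>\<open>ARG_MIN\<close> chooses some minimizer, so its value is known only if the
    minimizer is unique: \<open>W0\<close> attains the minimum, and coercivity forces any other
    minimizer to coincide with it.\<close>
  have "lmmse_matrix M u r = W0"
    unfolding lmmse_matrix_def arg_min_def is_arg_min_def mse
  proof (rule some_equality)
    show "True \<and> \<not> (\<exists>W. True \<and>
        Re (trace (C e e)) + Re (trace (ctranspose (W - W0) ** S ** (W - W0)))
        < Re (trace (C e e)) + Re (trace (ctranspose (W0 - W0) ** S ** (W0 - W0))))"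
    proof -
      have "0 \<le> Re (trace (ctranspose (W - W0) ** S ** (W - W0)))" for W
        using coercive[of "W - W0"] v order_trans[of 0 "v * (norm (W - W0))\<^sup>2"] by simp
      then show ?thesis by (simp add: trace_def not_less)
    qed
  next
    fix W
    assume "True \<and> \<not> (\<exists>V. True \<and>
        Re (trace (C e e)) + Re (trace (ctranspose (V - W0) ** S ** (V - W0)))
        < Re (trace (C e e)) + Re (trace (ctranspose (W - W0) ** S ** (W - W0))))"
    then have "\<not> Re (trace (C e e)) + Re (trace (ctranspose (W0 - W0) ** S ** (W0 - W0)))
        < Re (trace (C e e)) + Re (trace (ctranspose (W - W0) ** S ** (W - W0)))"
      by blast
    then have "Re (trace (ctranspose (W - W0) ** S ** (W - W0))) \<le> 0"
      by (simp add: trace_def)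
    then have "v * (norm (W - W0))\<^sup>2 \<le> 0" using coercive[of "W - W0"] by linarith
    then show "W = W0" using v by (simp add: mult_le_0_iff)
  qed
  then have est: "lmmse_estimate M u r = (\<lambda>\<omega>. r \<omega> ** W0)"
    by (auto simp: lmmse_estimate_def)
  have intr: "integrable M (\<lambda>\<omega>. r \<omega> ** W0)"
    by (rule integrable_matrix_square_integrable[OF srW])
  have intu: "integrable M u" by (rule integrable_matrix_square_integrable[OF u(1)])
  have "(\<integral>\<omega>. r \<omega> \<partial>M) = 0"
    unfolding req
    using u(2) white_integral[OF n] intu integrable_matrix_square_integrable[OF sn]
    by (simp add: Bochner_Integration.integral_add)
  then have mr: "(\<integral>\<omega>. r \<omega> ** W0 \<partial>M) = 0"
    using integral_mult_right_matrix[OF integrable_matrix_square_integrable[OF sr], of W0]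
    by simp
  have "C (\<lambda>\<omega>. r \<omega> ** W0) (\<lambda>\<omega>. r \<omega> ** W0) = R ** Q ** R"
    using gram[OF sr sr, of W0 W0] by (simp add: Crr matrix_mul_assoc[symmetric] SW0 hW0)
  then show "zero_mean_with_cov M (lmmse_estimate M u r) (R ** Q ** R)"
    unfolding est zero_mean_with_cov_def
    using intr mr integrable_gram[OF srW srW] by (simp add: C_def)
  show "zero_mean_with_cov M (\<lambda>\<omega>. u \<omega> - lmmse_estimate M u r \<omega>) (R - R ** Q ** R)"
    unfolding est zero_mean_with_cov_def e_def[symmetric]
  proof (intro conjI)
    show "integrable M e" by (rule integrable_matrix_square_integrable[OF se])
    show "(\<integral>\<omega>. e \<omega> \<partial>M) = 0"
      unfolding e_def using u(2) mr intu intr by (simp add: Bochner_Integration.integral_diff)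
    show "integrable M (\<lambda>\<omega>. ctranspose (e \<omega>) ** e \<omega>)" by (rule integrable_gram[OF se se])
    show "(\<integral>\<omega>. ctranspose (e \<omega>) ** e \<omega> \<partial>M) = R - R ** Q ** R" using Cee by (simp add: C_def)
  qed
qed

subsection \<open>The cascaded channel\<close>

lemma scaleR_matrix_mult:
  fixes A :: "complex^'n^'m" and B :: "complex^'k^'n"
  shows "(x *\<^sub>R A) ** B = x *\<^sub>R (A ** B)" "A ** (x *\<^sub>R B) = x *\<^sub>R (A ** B)"
  by (simp_all add: vec_eq_iff matrix_matrix_mult_def scaleR_sum_right)

text \<open>\<open>R\<close> is introduced as the expectation itself, so its closed form is proved
  rather than assumed. The witness \<open>e\<close> is forced to be the estimation error.\<close>

theorem proposition2:
  fixes P :: "'a measure"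
    and K :: nat
    and w :: "nat \<Rightarrow> user_side"
    and Rb :: "complex^'m^'m"
    and Rs :: "complex^'n^'n"
    and \<Theta> :: "user_side \<Rightarrow> complex^'n^'n"
    and \<delta>g :: real
    and \<delta>h :: "nat \<Rightarrow> real"
    and \<sigma> :: "nat \<Rightarrow> real"
    and \<tau> :: nat
    and p_train :: real
    and D :: "'a \<Rightarrow> complex^'m^'n"
    and c :: "nat \<Rightarrow> 'a \<Rightarrow> complex^'n^1"
    and noise :: "nat \<Rightarrow> 'a \<Rightarrow> complex^'m^1"
    and G :: "'a \<Rightarrow> complex^'m^'n"
    and h :: "nat \<Rightarrow> 'a \<Rightarrow> complex^'n^1"
    and u r :: "nat \<Rightarrow> 'a \<Rightarrow> complex^'m^1"
    and R Q \<Psi> E :: "nat \<Rightarrow> complex^'m^'m"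
  assumes "prob_space P"
    and "hermitian_psd Rb" and "hermitian_psd Rs"
    and "\<And>s i j. i \<noteq> j \<Longrightarrow> \<Theta> s $ i $ j = 0"
    and "\<delta>g > 0" and "\<And>k. k \<in> {1..K} \<Longrightarrow> \<delta>h k > 0"
    and "\<And>k. k \<in> {1..K} \<Longrightarrow> (\<sigma> k)\<^sup>2 > 0"
    and "\<tau> > 0" and "p_train > 0"
    and "iid_complex_gaussian P 1 D"
    and "\<And>k. k \<in> {1..K} \<Longrightarrow> iid_complex_gaussian P 1 (c k)"
    and "\<And>k. k \<in> {1..K} \<Longrightarrow> indep_elements P D (c k)"
    and G_def: "\<And>\<omega>. G \<omega> = sqrt \<delta>g *\<^sub>R (psd_sqrt Rs ** D \<omega> ** psd_sqrt Rb)"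
    and h_def: "\<And>k \<omega>. h k \<omega> = sqrt (\<delta>h k) *\<^sub>R (c k \<omega> ** psd_sqrt Rs)"
    and u_def: "\<And>k \<omega>. u k \<omega> = h k \<omega> ** \<Theta> (w k) ** G \<omega>"
    and "\<And>k. k \<in> {1..K} \<Longrightarrow>
           iid_complex_gaussian P ((\<sigma> k)\<^sup>2 / (real \<tau> * p_train)) (noise k)"
    and "\<And>k. k \<in> {1..K} \<Longrightarrow>
           indep_elements P (\<lambda>\<omega>. (h k \<omega>, G \<omega>)) (noise k)"
    and r_def: "\<And>k \<omega>. r k \<omega> = u k \<omega> + noise k \<omega>"
    and R_def: "\<And>k. R k = (\<integral>\<omega>. ctranspose (u k \<omega>) ** u k \<omega> \<partial>P)"
    and Q_def: "\<And>k. Q k = matrix_inv (R k + mat (of_real ((\<sigma> k)\<^sup>2 / (real \<tau> * p_train))))"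
    and \<Psi>_def: "\<And>k. \<Psi> k = R k ** Q k ** R k"
    and E_def: "\<And>k. E k = R k - \<Psi> k"
  shows "\<forall>k\<in>{1..K}.
           R k = mat (of_real (\<delta>g * \<delta>h k) *
                      trace (Rs ** \<Theta> (w k) ** Rs ** ctranspose (\<Theta> (w k)))) ** Rb \<and>
           (\<exists>e. (\<forall>\<omega>. u k \<omega> = lmmse_estimate P (u k) (r k) \<omega> + e \<omega>) \<and>
                zero_mean_with_cov P (lmmse_estimate P (u k) (r k)) (\<Psi> k) \<and>
                zero_mean_with_cov P e (E k))"
proof
  fix k assume k: "k \<in> {1..K}"
  interpret prob_space P by fact
  define v where "v = (\<sigma> k)\<^sup>2 / (real \<tau> * p_train)"
  have v: "0 < v" using assms(7)[OF k] assms(8,9) by (simp add: v_def)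
  define \<alpha> where "\<alpha> = \<delta>g * \<delta>h k"
  have \<alpha>: "0 < \<alpha>" using assms(5) assms(6)[OF k] by (simp add: \<alpha>_def)
  define S where "S = psd_sqrt Rs"
  define B where "B = psd_sqrt Rb"
  define T where "T = S ** \<Theta> (w k) ** S"
  have S: "ctranspose S = S" "S ** S = Rs" and B: "ctranspose B = B" "B ** B = Rb"
    using psd_sqrt assms(2,3) by (auto simp: S_def B_def hermitian_psd_def)
  have white_D: "white P 1 D" and white_c: "white P 1 (c k)" and white_n: "white P v (noise k)"
    using assms(10) assms(11,16)[OF k] v by (auto simp: v_def intro: iid_complex_gaussian_white)
  \<comment> \<open>Cyclicity of the trace, used twice: it joins the two outer roots
    \<open>S\<close> into \<open>Rs\<close>, then moves \<open>ctranspose (\<Theta> (w k))\<close>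
    to the end.\<close>
  have Teq: "trace (ctranspose T ** T) = trace (Rs ** \<Theta> (w k) ** Rs ** ctranspose (\<Theta> (w k)))"
  proof -
    have "ctranspose T ** T = S ** (ctranspose (\<Theta> (w k)) ** Rs ** \<Theta> (w k) ** S)"
      by (simp add: T_def ctranspose_mult S(1) matrix_mul_assoc flip: S(2))
    then have "trace (ctranspose T ** T) = trace ((ctranspose (\<Theta> (w k)) ** Rs ** \<Theta> (w k) ** S) ** S)"
      using trace_mul_sym[of S] by metis
    also have "\<dots> = trace ((ctranspose (\<Theta> (w k))) ** (Rs ** \<Theta> (w k) ** Rs))"
      by (simp add: S(2) flip: matrix_mul_assoc)
    also have "\<dots> = trace (Rs ** \<Theta> (w k) ** Rs ** ctranspose (\<Theta> (w k)))"
      by (rule trace_mul_sym)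
    finally show ?thesis .
  qed
  define Y where "Y \<omega> = c k \<omega> ** T" for \<omega>
  have sc: "matrix_square_integrable P (c k)" using white_c by (simp add: white_def)
  have sY: "matrix_square_integrable P Y"
    unfolding Y_def by (rule matrix_square_integrable_mult[OF sc])
  have gramY: "(\<integral>\<omega>. ctranspose (Y \<omega>) ** Y \<omega> \<partial>P) = ctranspose T ** T"
    using integral_gram_mult[OF sc sc, of T T] white_row_gram[OF white_c] by (simp add: Y_def)
  have "(\<lambda>X::complex^'n^1. X ** T) \<in> borel_measurable borel"
    unfolding matrix_matrix_mult_def by (intro borel_measurable_continuous_onI continuous_intros)
  from indep_elements_compose[OF assms(12)[OF k] measurable_ident this]
  have indDY: "indep_elements P D Y" by (simp add: Y_def[abs_def])
  note YD = indep_white_mult[OF indDY white_D sY]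
  \<comment> \<open>The roots of \<open>Rs\<close> from \<open>h\<close> and from \<open>G\<close>
    are absorbed into \<open>T\<close>, and the two scalar factors merge into
    \<open>sqrt \<alpha>\<close>.\<close>
  have u_eq: "u k = (\<lambda>\<omega>. (Y \<omega> ** D \<omega>) ** (sqrt \<alpha> *\<^sub>R B))"
    by (auto simp: u_def G_def h_def Y_def T_def S_def B_def \<alpha>_def real_sqrt_mult matrix_mul_assoc
        scaleR_matrix_mult mult.commute)
  have su: "matrix_square_integrable P (u k)"
    unfolding u_eq by (rule matrix_square_integrable_mult[OF YD(1)])
  have mu: "(\<integral>\<omega>. u k \<omega> \<partial>P) = 0"
    unfolding u_eq
    using integral_mult_right_matrix[OF integrable_matrix_square_integrable[OF YD(1)]] YD(2)
    by simp
  have "R k = ctranspose (sqrt \<alpha> *\<^sub>R B) ** mat (trace (ctranspose T ** T)) ** (sqrt \<alpha> *\<^sub>R B)"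
    unfolding R_def u_eq using integral_gram_mult[OF YD(1) YD(1)] YD(3) gramY by simp
  \<comment> \<open>The middle factor is a scalar matrix and commutes out, leaving the square of
    \<open>sqrt \<alpha>\<close> and \<open>B ** B = Rb\<close>.\<close>
  also have "\<dots> = mat (of_real \<alpha> * trace (ctranspose T ** T)) ** Rb"
  proof -
    have "ctranspose (sqrt \<alpha> *\<^sub>R B) = sqrt \<alpha> *\<^sub>R B"
      using B(1) by (simp add: vec_eq_iff)
    then have "ctranspose (sqrt \<alpha> *\<^sub>R B) ** mat (trace (ctranspose T ** T)) ** (sqrt \<alpha> *\<^sub>R B)
        = mat (trace (ctranspose T ** T)) ** (\<alpha> *\<^sub>R Rb)"
      using \<alpha> by (simp add: scaleR_matrix_mult B(2) mat_commute flip: matrix_mul_assoc)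
    also have "\<dots> = mat (of_real \<alpha> * trace (ctranspose T ** T)) ** Rb"
      by (simp add: vec_eq_iff scaleR_conv_of_real[where 'a = complex])
    finally show ?thesis .
  qed
  finally have R: "R k = mat (of_real (\<delta>g * \<delta>h k) *
      trace (Rs ** \<Theta> (w k) ** Rs ** ctranspose (\<Theta> (w k)))) ** Rb"
    by (simp add: Teq \<alpha>_def)
  \<comment> \<open>Entries of \<open>u k\<close> are Borel functions of the pair
    \<open>(h k, G)\<close>, hence independent of the noise; the cross moments factor, and the noise
    has mean zero.\<close>
  have uncorrelated: "(\<integral>\<omega>. ctranspose (u k \<omega>) ** noise k \<omega> \<partial>P) = 0"
  proof -
    have sn: "matrix_square_integrable P (noise k)" using white_n by (simp add: white_def)
    have "(\<integral>\<omega>. cnj (u k \<omega> $ 1 $ i) * noise k \<omega> $ 1 $ j \<partial>P) = 0" for i j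
    proof -
      have "(\<lambda>p. (case p of (X, Z) \<Rightarrow> X ** \<Theta> (w k) ** Z) $ 1 $ i) \<in> borel_measurable borel"
        for i :: 'm
        using measurable_compose[OF borel_measurable_matrix_mult borel_measurable_matrix_nth] .
      from indep_elements_compose[OF assms(17)[OF k] this borel_measurable_matrix_nth]
      have "indep_var borel (\<lambda>\<omega>. u k \<omega> $ 1 $ i) borel (\<lambda>\<omega>. noise k \<omega> $ 1 $ j)"
        by (intro indep_elements_indep_var) (simp add: u_def)
      from indep_var_cnj_mult[OF this] su sn white_n show ?thesis
        by (simp add: matrix_square_integrable_def white_def)
    qed
    then show ?thesis by (simp add: vec_eq_iff integral_gram_row[OF su sn])
  qed
  have Qk: "Q k = matrix_inv (R k + mat (of_real v))" by (simp add: Q_def v_def)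
  note est = lmmse_white_noise[OF su mu white_n v uncorrelated r_def R_def Qk]
  show "R k = mat (of_real (\<delta>g * \<delta>h k) *
          trace (Rs ** \<Theta> (w k) ** Rs ** ctranspose (\<Theta> (w k)))) ** Rb \<and>
        (\<exists>e. (\<forall>\<omega>. u k \<omega> = lmmse_estimate P (u k) (r k) \<omega> + e \<omega>) \<and>
          zero_mean_with_cov P (lmmse_estimate P (u k) (r k)) (\<Psi> k) \<and>
          zero_mean_with_cov P e (E k))"
    using R est unfolding \<Psi>_def E_def
    by (intro conjI exI[of _ "\<lambda>\<omega>. u k \<omega> - lmmse_estimate P (u k) (r k) \<omega>"]) simp_all
qed

end
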